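(* Let $d\ge1$, $\mathcal{X}=[0,1]$, $\mathcal{X}^d=[0,1]^d$, and let $K$ be a bounded subset of $\mathbb{R}$. Let the target function $f_0:\mathcal{X}^d\to K$ be weakly increasing and measurable. Let $\hat f:\mathcal{X}^d\to K$ be a measurable function (an initial estimate of $f_0$), and let $\bar f:\mathcal{X}^d\to K$ be another measurable estimate of $f_0$ (which may be, for example, $\hat f$ rearranged with respect to some of its arguments). Let $\Pi$ be any nonempty finite collection of orderings of $1,\ldots,d$. 1. For each ordering $\pi$ of $1,\ldots,d$, the $\pi$-rearranged estimate $\hat f^*_\pi$ is weakly increasing on $\mathcal{X}^d$. Moreover, the average rearrangement $\hat f^*=\frac{1}{|\Pi|}\sum_{\pi\in\Pi}\hat f^*_\pi$ is weakly increasing on $\mathcal{X}^d$. 2. (a) For any $j\in\{1,\ldots,d\}$ and any $p\in[1,\infty]$, $$\left\{\int_{\mathcal{X}^d}|\bar f_j^*(x)-f_0(x)|^p dx\right\}^{1/p}\le\left\{\int_{\mathcal{X}^d}|\bar f(x)-f_0(x)|^p dx\right\}^{1/p}.$$ (b) For any ordering $\pi$ and any $p\in[1,\infty]$, $$\left\{\int_{\mathcal{X}^d}|\hat f^*_\pi(x)-f_0(x)|^p dx\right\}^{1/p}\le\left\{\int_{\mathcal{X}^d}|\hat f(x)-f_0(x)|^p dx\right\}^{1/p}.$$ 3. For $j\in\{1,\ldots,d\}$ and constants $\delta,\nu,\epsilon>0$, consider the following condition on the pair $(\bar f,f_0)$: there exist measurable subsets $\mathcal{X}_j\subset\mathcal{X}$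 and $\mathcal{X}_j'\subset\mathcal{X}$, each of measure greater than $\delta$, and a measurable subset $\mathcal{X}_{-j}\subseteq\mathcal{X}^{d-1}$ of measure $\nu$, such that for all $x=(x_j,x_{-j})$ and $x'=(x_j',x_{-j})$ with $x_j'\in\mathcal{X}_j'$, $x_j\in\mathcal{X}_j$, $x_{-j}\in\mathcal{X}_{-j}$: (i) $x_j'>x_j$, (ii) $\bar f(x)>\bar f(x')+\epsilon$, and (iii) $f_0(x')>f_0(x)+\epsilon$. (a) If this condition holds, then for any $p\in(1,\infty)$, $$\left\{\int_{\mathcal{X}^d}|\bar f_j^*(x)-f_0(x)|^p dx\right\}^{1/p}\le\left\{\int_{\mathcal{X}^d}|\bar f(x)-f_0(x)|^p dx-\eta_p\,\delta\,\nu\right\}^{1/p},$$ where $$\eta_p=\inf\left\{|v-t'|^p+|v'-t|^p-|v-t|^p-|v'-t'|^p\right\}>0,$$ the infimum being taken over all $v,v',t,t'\in K$ such that $v'\ge v+\epsilon$ and $t'\ge t+\epsilon$ (the positivity of $\eta_p$ is part of the assertion). (b) Further, for an ordering $\pi=(\pi_1,\ldots,\pi_k,\ldots,\pi_d)$ with $\pi_k=j$, let $\bar f$ now be the partially rearranged function $\bar f=R_{\pi_{k+1}}\cdots R_{\pi_d}\hat f$ (for $k=d$, $\bar f=\hat f$). If this $\bar f$ and $f_0$ satisfy the condition above, then, for any $p\in(1,\infty)$ and $\eta_p$ as in (a), $$\left\{\int_{\mathcal{X}^d}|\hat f^*_\pi(x)-f_0(x)|^p dx\right\}^{1/p}\le\left\{\int_{\mathcal{X}^d}|\hat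 f(x)-f_0(x)|^p dx-\eta_p\,\delta\,\nu\right\}^{1/p}.$$ 4. For any $p\in[1,\infty]$, $$\left\{\int_{\mathcal{X}^d}|\hat f^*(x)-f_0(x)|^p dx\right\}^{1/p}\le\frac{1}{|\Pi|}\sum_{\pi\in\Pi}\left\{\int_{\mathcal{X}^d}|\hat f^*_\pi(x)-f_0(x)|^p dx\right\}^{1/p}.$$
   Context: A function $f$ on $[0,1]^d$ is weakly increasing if $f(x')\le f(x)$ whenever $x'\le x$ componentwise. Write $f(x_j,x_{-j})$ for the value of $f$ at $x$, with $x_{-j}\in[0,1]^{d-1}$ denoting all arguments other than $x_j$. Measure means Lebesgue measure (for $d=1$, $\mathcal{X}^{0}$ is a single point of measure $1$). Rearrangement with respect to $x_j$: for measurable $f$ on $[0,1]^d$, $$f_j^*(x)=R_jf(x)=\inf\left\{y\in\mathbb{R}:\int_0^1 1\{f(x_j',x_{-j})\le y\}\,dx_j'\ge x_j\right\},$$ i.e. the one-dimensional increasing rearrangement (quantile function) of $x_j\mapsto f(x_j,x_{-j})$, for each fixed $x_{-j}$. For an ordering (permutation) $\pi=(\pi_1,\ldots,\pi_d)$ of $1,\ldots,d$, the $\pi$-rearrangement of $f$ is $f^*_\pi=R_\pi f=R_{\pi_1}\cdots R_{\pi_d}f$ (so $R_{\pi_d}$ is applied first). For a nonempty finite collection $\Pi$ of orderings, the average rearrangement is $f^*=\frac{1}{|\Pi|}\sum_{\pi\in\Pi}f^*_\pi$. Conventions: the infimum is $-\infty$ when $x_j=0$, so rearranged functions are read as extended-real-valued;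 they are finite outside the null set where some rearranged coordinate equals $0$, which does not affect integrals. For $p=\infty$, $\{\int|g|^p\}^{1/p}$ denotes the essential supremum of $|g|$. *)

theory Defs
  imports "HOL-Probability.Probability" "HOL-Combinatorics.Permutations"
begin

text \<open>
  Points of the unit cube with coordinates in \<open>I\<close> are extensional functions on \<open>I\<close>, so the
  pointwise order on functions restricts to the componentwise order on \<open>cube I\<close>, and
  \<open>cube {}\<close> is a single point.  If \<open>j \<in> I\<close> and \<open>z \<in> cube (I - {j})\<close>, the point
  \<open>(x\<^sub>j, x\<^sub>-\<^sub>j)\<close> with \<open>x\<^sub>j = t\<close> and \<open>x\<^sub>-\<^sub>j = z\<close> is \<open>z(j := t)\<close>.
\<close>

definition cube :: "nat set \<Rightarrow> (nat \<Rightarrow> real) set" where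
  "cube I = (\<Pi>\<^sub>E i\<in>I. {0..1})"

text \<open>
  Lebesgue measure (the completion of the Borel product measure) on the cube; for \<open>I = {}\<close> it
  is the unit mass on the single point.
\<close>

definition cube_measure :: "nat set \<Rightarrow> (nat \<Rightarrow> real) measure" where
  "cube_measure I = restrict_space (completion (\<Pi>\<^sub>M i\<in>I. lborel)) (cube I)"

text \<open>
  A Lebesgue measurable \<open>f\<close> may have non-measurable slices for a null set of \<open>x\<^sub>-\<^sub>j\<close>; there
  \<open>nn_integral\<close> is the lower integral (inner measure), so the definition is still meaningful.
\<close>

definition rearr :: "nat \<Rightarrow> ((nat \<Rightarrow> real) \<Rightarrow> ereal) \<Rightarrow> (nat \<Rightarrow> real) \<Rightarrow> ereal" where
  "rearr j f x =
     (INF y \<in> {y::real. (\<integral>\<^sup>+ t. indicator {t. f (x(j := t)) \<le> ereal y} t \<partial>lebesgue_on {0..1})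
                        \<ge> ennreal (x j)}. ereal y)"

definition orderings :: "nat \<Rightarrow> (nat \<Rightarrow> nat) set" where
  "orderings d = {\<pi>. \<pi> permutes {1..d}}"

text \<open>
  \<open>rearr_from k d \<pi> f\<close> is \<open>R\<^bsub>\<pi> k\<^esub> \<dots> R\<^bsub>\<pi> d\<^esub> f\<close>, with \<open>R\<^bsub>\<pi> d\<^esub>\<close> applied first; it is \<open>f\<close> for \<open>k > d\<close>.
\<close>

definition rearr_from ::
    "nat \<Rightarrow> nat \<Rightarrow> (nat \<Rightarrow> nat) \<Rightarrow> ((nat \<Rightarrow> real) \<Rightarrow> ereal) \<Rightarrow> (nat \<Rightarrow> real) \<Rightarrow> ereal" where
  "rearr_from k d \<pi> f = foldr (\<lambda>i. rearr (\<pi> i)) [k..<Suc d] f"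

definition pi_rearr ::
    "nat \<Rightarrow> (nat \<Rightarrow> nat) \<Rightarrow> ((nat \<Rightarrow> real) \<Rightarrow> ereal) \<Rightarrow> (nat \<Rightarrow> real) \<Rightarrow> ereal" where
  "pi_rearr d \<pi> f = rearr_from 1 d \<pi> f"

definition avg_rearr ::
    "nat \<Rightarrow> (nat \<Rightarrow> nat) set \<Rightarrow> ((nat \<Rightarrow> real) \<Rightarrow> ereal) \<Rightarrow> (nat \<Rightarrow> real) \<Rightarrow> ereal" where
  "avg_rearr d P f x = (\<Sum>\<pi>\<in>P. pi_rearr d \<pi> f x) / ereal (real (card P))"

text \<open>Power with a real exponent \<open>a > 0\<close> on \<open>[0, \<infinity>]\<close>.\<close>

definition epowr :: "ennreal \<Rightarrow> real \<Rightarrow> ennreal" where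
  "epowr u a = (if u = \<top> then \<top> else ennreal (enn2real u powr a))"

definition lp_int :: "nat \<Rightarrow> real \<Rightarrow> ((nat \<Rightarrow> real) \<Rightarrow> ereal) \<Rightarrow> ennreal" where
  "lp_int d p g = (\<integral>\<^sup>+ x. epowr (e2ennreal \<bar>g x\<bar>) p \<partial>cube_measure {1..d})"

definition lp_norm :: "nat \<Rightarrow> ennreal \<Rightarrow> ((nat \<Rightarrow> real) \<Rightarrow> ereal) \<Rightarrow> ennreal" where
  "lp_norm d p g =
     (if p = \<top> then esssup (cube_measure {1..d}) (\<lambda>x. e2ennreal \<bar>g x\<bar>)
      else epowr (lp_int d (enn2real p) g) (1 / enn2real p))"

definition strict_gain_cond ::
    "nat \<Rightarrow> nat \<Rightarrow> real \<Rightarrow> real \<Rightarrow> real \<Rightarrow> ((nat \<Rightarrow> real) \<Rightarrow> ereal) \<Rightarrow> ((nat \<Rightarrow> real) \<Rightarrow> real) \<Rightarrow> bool" where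
  "strict_gain_cond d j \<delta> \<nu> \<epsilon> f f0 \<longleftrightarrow>
     (\<exists>A \<in> sets (lebesgue_on {0..1}). \<exists>A' \<in> sets (lebesgue_on {0..1}).
      \<exists>Z \<in> sets (cube_measure ({1..d} - {j})).
        measure (lebesgue_on {0..1}) A > \<delta> \<and>
        measure (lebesgue_on {0..1}) A' > \<delta> \<and>
        measure (cube_measure ({1..d} - {j})) Z = \<nu> \<and>
        (\<forall>s\<in>A. \<forall>t\<in>A'. \<forall>z\<in>Z.
           t > s \<and>
           f (z(j := s)) > f (z(j := t)) + ereal \<epsilon> \<and>
           f0 (z(j := t)) > f0 (z(j := s)) + \<epsilon>))"

definition eta :: "real set \<Rightarrow> real \<Rightarrow> real \<Rightarrow> real" where
  "eta K \<epsilon> p =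
     Inf {\<bar>v - t'\<bar> powr p + \<bar>v' - t\<bar> powr p - \<bar>v - t\<bar> powr p - \<bar>v' - t'\<bar> powr p | v v' t t'.
            v \<in> K \<and> v' \<in> K \<and> t \<in> K \<and> t' \<in> K \<and> v' \<ge> v + \<epsilon> \<and> t' \<ge> t + \<epsilon>}"

end

theory Submission
  imports Defs
begin

text \<open>
  Fix all coordinates but \<open>x\<^sub>j\<close>.  For a convex cost \<open>c\<close> with right-continuous slope \<open>\<phi>\<close>, the double
  difference \<open>c (v - t') + c (v' - t) - c (v - t) - c (v' - t')\<close> is the mass of the rectangle
  \<open>(v, v'] \<times> [t, t')\<close> in the plane of levels under \<open>d\<phi>(y - w) dw\<close>.  Integrating it along a slice turns
  \<open>\<integral> c (f - g)\<close>, up to terms that depend only on the distributions of \<open>f\<close> and \<open>g\<close>, into minus the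
  integral over the levels of \<open>|{f \<ge> y} \<inter> {g > w}|\<close>.  For increasing functions the super-level sets are
  nested, so this quantity equals \<open>min |f \<ge> y| |g > w|\<close>, the largest possible value.  The deficit for
  the unsorted \<open>f\<close> is \<open>min |f \<ge> y, g \<le> w| |f < y, g > w|\<close>, which is at least \<open>a b / max |A| |A'|\<close>
  where \<open>a\<close> and \<open>b\<close> are the parts of these two sets in \<open>A\<close> and \<open>A'\<close>; integrating \<open>a b\<close> over the levels
  gives the average of the double differences over \<open>A \<times> A'\<close>, hence a gain of at least
  \<open>\<eta> min |A| |A'|\<close>.  The costs \<open>|u|\<^sup>p\<close> give the finite exponents, and \<open>max 0 (|u| - M)\<close> gives the
  essential supremum.
\<close>

section \<open>Lebesgue measure on the cube\<close>

text \<open>Lebesgue measurable functions may have non-measurable slices, and rearranged ones are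
  \<open>-\<infinity>\<close> on a face of the cube, so the slice inequality cannot be applied to
  them directly. Each function is therefore paired with a real-valued Borel version that equals it
  almost everywhere, and rearrangement is shown to carry versions to versions. Rearranged values are
  infima and may leave \<open>K\<close>, but not its closure; hence the argument runs with a closed
  bounded set \<open>C\<close>, and only the bound by \<open>eta\<close> is brought back to
  \<open>K\<close>. On slices the target \<open>f0\<close> is used as it stands, because it is
  increasing at every point while a Borel version of it need not be.

  Monotonicity is asserted at every point and for extended values, so it cannot pass through
  versions; it rests on order properties of the quantile alone.

  Subtraction in \<open>ennreal\<close> is delicate. The slice identities are therefore written as
  sums, a level \<open>lo\<close> below all values anchors the rectangles so that every term is
  nonnegative, and bounded values make the terms finite that have to be cancelled.\<close>

interpretation lborel_product: product_sigma_finite "\<lambda>_::nat. lborel :: real measure"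
  by standard

lemma cube_sets [measurable]: "finite I \<Longrightarrow> cube I \<in> sets (\<Pi>\<^sub>M i\<in>I. lborel)"
  unfolding cube_def by (intro sets_PiM_I_finite) auto

lemma cube_sets_completion: "finite I \<Longrightarrow> cube I \<inter> space (completion (\<Pi>\<^sub>M i\<in>I. lborel)) \<in> sets (completion (\<Pi>\<^sub>M i\<in>I. lborel))"
  by (intro sets.Int sets.top sets_completionI_sets cube_sets)

lemma space_cube_measure [simp]: "space (cube_measure I) = cube I"
  by (auto simp: cube_measure_def space_restrict_space space_PiM cube_def)

lemma cube_update: "x \<in> cube I \<Longrightarrow> t \<in> {0..1} \<Longrightarrow> x(j := t) \<in> cube (insert j I)"
  by (auto simp: cube_def PiE_iff extensional_def)

lemma cube_update_iff:
  assumes "j \<notin> I" "z \<in> space (\<Pi>\<^sub>M i\<in>I. lborel)"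
  shows "z(j := t) \<in> cube (insert j I) \<longleftrightarrow> z \<in> cube I \<and> t \<in> {0..1}"
  using assms by (auto simp: cube_def PiE_iff space_PiM extensional_def split: if_splits)

text \<open>Completion leaves \<open>nn_integral\<close> unchanged for every \<open>h\<close>, so
  integrals over the cube can be computed with the plain product measure, where Tonelli is
  available.\<close>

lemma nn_integral_cube:
  assumes "finite I"
  shows "(\<integral>\<^sup>+x. h x \<partial>cube_measure I) = (\<integral>\<^sup>+x. h x * indicator (cube I) x \<partial>(\<Pi>\<^sub>M i\<in>I. lborel))"
  unfolding cube_measure_def
  by (simp add: nn_integral_restrict_space[OF cube_sets_completion[OF assms]] nn_integral_completion)

lemma AE_cube_iff:
  assumes "finite I"
  shows "(AE x in cube_measure I. P x) \<longleftrightarrow> (AE x in (\<Pi>\<^sub>M i\<in>I. lborel). x \<in> cube I \<longrightarrow> P x)"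
  unfolding cube_measure_def
  by (simp add: AE_restrict_space_iff[OF cube_sets_completion[OF assms]] AE_completion_iff)

lemma borel_measurable_cube:
  assumes "finite I" "f \<in> measurable (\<Pi>\<^sub>M i\<in>I. lborel) N"
  shows "f \<in> measurable (cube_measure I) N"
  unfolding cube_measure_def by (intro measurable_restrict_space1 measurable_completion assms)

lemma nn_integral_unit_interval:
  "(\<integral>\<^sup>+t. h t \<partial>lebesgue_on {0..1::real}) = (\<integral>\<^sup>+t. h t * indicator {0..1} t \<partial>lborel)"
  by (simp add: nn_integral_restrict_space nn_integral_completion)

lemma AE_unit_interval_iff:
  "(AE t in lebesgue_on {0..1::real}. P t) \<longleftrightarrow> (AE t in lborel. t \<in> {0..1} \<longrightarrow> P t)"
  by (simp add: AE_restrict_space_iff AE_completion_iff)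

lemma nn_integral_cube_insert:
  assumes [simp]: "finite I" "j \<notin> I"
    and [measurable]: "h \<in> borel_measurable (\<Pi>\<^sub>M i\<in>insert j I. lborel)"
  shows "(\<integral>\<^sup>+x. h x \<partial>cube_measure (insert j I)) =
    (\<integral>\<^sup>+z. (\<integral>\<^sup>+t. h (z(j := t)) \<partial>lebesgue_on {0..1}) \<partial>cube_measure I)"
proof -
  have [measurable]: "cube (insert j I) \<in> sets (\<Pi>\<^sub>M i\<in>insert j I. lborel)"
    by (rule cube_sets) simp
  have "(\<integral>\<^sup>+x. h x \<partial>cube_measure (insert j I)) =
     (\<integral>\<^sup>+x. h x * indicator (cube (insert j I)) x \<partial>(\<Pi>\<^sub>M i\<in>insert j I. lborel))"
    by (simp add: nn_integral_cube)
  also have "\<dots> = (\<integral>\<^sup>+z. (\<integral>\<^sup>+t. h (z(j := t)) * indicator (cube (insert j I)) (z(j := t)) \<partial>lborel)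
      \<partial>(\<Pi>\<^sub>M i\<in>I. lborel))"
    by (subst lborel_product.product_nn_integral_insert) auto
  also have "\<dots> = (\<integral>\<^sup>+z. (\<integral>\<^sup>+t. h (z(j := t)) \<partial>lebesgue_on {0..1}) * indicator (cube I) z
      \<partial>(\<Pi>\<^sub>M i\<in>I. lborel))"
  proof (rule nn_integral_cong)
    fix z assume z: "z \<in> space (\<Pi>\<^sub>M i\<in>I. (lborel :: real measure))"
    show "(\<integral>\<^sup>+t. h (z(j := t)) * indicator (cube (insert j I)) (z(j := t)) \<partial>lborel) =
      (\<integral>\<^sup>+t. h (z(j := t)) \<partial>lebesgue_on {0..1}) * indicator (cube I) z"
      unfolding nn_integral_unit_interval
      by (cases "z \<in> cube I") (auto intro!: nn_integral_cong simp: cube_update_iff[OF _ z] indicator_def)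
  qed
  also have "\<dots> = (\<integral>\<^sup>+z. (\<integral>\<^sup>+t. h (z(j := t)) \<partial>lebesgue_on {0..1}) \<partial>cube_measure I)"
    by (simp add: nn_integral_cube)
  finally show ?thesis .
qed

text \<open>Tonelli for the indicator of a product-measurable null set \<open>N\<close> that covers
  all exceptions; \<open>P\<close> itself may be non-measurable.\<close>

lemma AE_cube_slice:
  assumes I [simp]: "finite I" "j \<notin> I"
    and P: "AE x in cube_measure (insert j I). P x"
  shows "AE z in cube_measure I. AE t in lebesgue_on {0..1}. P (z(j := t))"
proof -
  obtain N where N: "{x \<in> space (\<Pi>\<^sub>M i\<in>insert j I. (lborel :: real measure)). \<not> (x \<in> cube (insert j I) \<longrightarrow> P x)} \<subseteq> N"
      "emeasure (\<Pi>\<^sub>M i\<in>insert j I. lborel) N = 0" and [measurable]: "N \<in> sets (\<Pi>\<^sub>M i\<in>insert j I. lborel)"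
    using P by (auto simp: AE_cube_iff elim!: AE_E)
  have "(\<integral>\<^sup>+x. indicator N x \<partial>(\<Pi>\<^sub>M i\<in>insert j I. lborel)) = 0"
    using N by simp
  then have "(\<integral>\<^sup>+z. (\<integral>\<^sup>+t. indicator N (z(j := t)) \<partial>lborel) \<partial>(\<Pi>\<^sub>M i\<in>I. lborel)) = 0"
    by (subst (asm) lborel_product.product_nn_integral_insert) auto
  then have ae: "AE z in (\<Pi>\<^sub>M i\<in>I. lborel). (\<integral>\<^sup>+t. indicator N (z(j := t)) \<partial>lborel) = 0"
    by (subst (asm) nn_integral_0_iff_AE) auto
  show ?thesis
    unfolding AE_cube_iff[OF I(1)] AE_unit_interval_iff
    using ae AE_space
  proof eventually_elim
    case (elim z)
    have "(\<lambda>t. z(j := t)) \<in> measurable lborel (\<Pi>\<^sub>M i\<in>insert j I. lborel)"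
      using elim by (intro measurable_component_update) auto
    then have "AE t in lborel. indicator N (z(j := t)) = (0 :: ennreal)"
      using elim by (subst (asm) nn_integral_0_iff_AE) (auto intro: measurable_compose)
    then show ?case
    proof (intro impI, eventually_elim, intro impI)
      fix t :: real assume t: "indicator N (z(j := t)) = (0 :: ennreal)" "t \<in> {0..1}" and z: "z \<in> cube I"
      have "z(j := t) \<in> cube (insert j I)"
        using cube_update[OF z t(2)] .
      moreover have "z(j := t) \<in> space (\<Pi>\<^sub>M i\<in>insert j I. (lborel :: real measure))"
        using elim(2) by (auto simp: space_PiM PiE_iff extensional_def)
      moreover have "z(j := t) \<notin> N" using t(1) by (auto simp: indicator_def split: if_splits)
      ultimately show "P (z(j := t))" using N(1) by blast
    qed
  qed
qed

text \<open>The cylinder over a null set is null. A rearranged value at \<open>x\<close> depends on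
  the entire slice through \<open>x\<close>, so facts about almost every slice have to be returned
  to almost every point.\<close>

lemma AE_cube_lift:
  assumes I [simp]: "finite I" "j \<notin> I"
    and P: "AE z in cube_measure I. P z"
  shows "AE x in cube_measure (insert j I). P (restrict x I)"
proof -
  obtain N where N: "{x \<in> space (\<Pi>\<^sub>M i\<in>I. (lborel :: real measure)). \<not> (x \<in> cube I \<longrightarrow> P x)} \<subseteq> N"
      "emeasure (\<Pi>\<^sub>M i\<in>I. lborel) N = 0" and [measurable]: "N \<in> sets (\<Pi>\<^sub>M i\<in>I. lborel)"
    using P by (auto simp: AE_cube_iff elim!: AE_E)
  define h where "h x = (indicator N (restrict x I) :: ennreal)" for x :: "nat \<Rightarrow> real"
  have rm: "(\<lambda>x. restrict x I) \<in> measurable (\<Pi>\<^sub>M i\<in>insert j I. lborel) (\<Pi>\<^sub>M i\<in>I. (lborel :: real measure))"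
    by (rule measurable_restrict_subset) auto
  then have [measurable]: "h \<in> borel_measurable (\<Pi>\<^sub>M i\<in>insert j I. lborel)"
    unfolding h_def by measurable
  have "(\<integral>\<^sup>+x. h x \<partial>(\<Pi>\<^sub>M i\<in>insert j I. lborel)) =
      (\<integral>\<^sup>+z. (\<integral>\<^sup>+t. h (z(j := t)) \<partial>lborel) \<partial>(\<Pi>\<^sub>M i\<in>I. lborel))"
    by (subst lborel_product.product_nn_integral_insert) auto
  also have "\<dots> = (\<integral>\<^sup>+z. (\<integral>\<^sup>+t. indicator N z \<partial>(lborel::real measure)) \<partial>(\<Pi>\<^sub>M i\<in>I. lborel))"
  proof (intro nn_integral_cong)
    fix z and t :: real assume "z \<in> space (\<Pi>\<^sub>M i\<in>I. (lborel :: real measure))"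
    then have "restrict (z(j := t)) I = z"
      by (auto simp: space_PiM PiE_iff extensional_def restrict_def fun_eq_iff)
    then show "h (z(j := t)) = indicator N z" by (simp add: h_def)
  qed
  \<comment> \<open>For \<open>z\<close> in \<open>N\<close> the inner integral is infinite, the
    line having infinite length; \<open>N\<close> is discarded before integrating over
    \<open>z\<close>.\<close>
  also have "\<dots> = 0"
  proof -
    have "AE z in (\<Pi>\<^sub>M i\<in>I. (lborel :: real measure)). z \<notin> N"
      using N(2) by (intro AE_not_in) auto
    then have "(\<integral>\<^sup>+z. (\<integral>\<^sup>+t. indicator N z \<partial>(lborel::real measure)) \<partial>(\<Pi>\<^sub>M i\<in>I. lborel)) =
        (\<integral>\<^sup>+z. 0 \<partial>(\<Pi>\<^sub>M i\<in>I. (lborel::real measure)))"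
      by (intro nn_integral_cong_AE) (auto elim!: eventually_mono)
    then show ?thesis by simp
  qed
  finally have ae: "AE x in (\<Pi>\<^sub>M i\<in>insert j I. lborel). h x = 0"
    by (subst (asm) nn_integral_0_iff_AE) auto
  show ?thesis
    unfolding AE_cube_iff[OF finite.insertI[OF I(1)]]
    using ae
  proof eventually_elim
    case (elim x)
    show ?case
    proof
      assume x: "x \<in> cube (insert j I)"
      then have "restrict x I \<in> cube I" by (auto simp: cube_def)
      moreover have "restrict x I \<in> space (\<Pi>\<^sub>M i\<in>I. (lborel :: real measure))" by (auto simp: space_PiM)
      moreover have "restrict x I \<notin> N" using elim by (auto simp: h_def indicator_def split: if_splits)
      ultimately show "P (restrict x I)" using N(1) by blast
    qed
  qed
qed

text \<open>This discards the face on which rearrangement in coordinate \<open>j\<close> takes the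
  value \<open>-\<infinity>\<close>.\<close>

lemma AE_cube_nonzero:
  assumes I [simp]: "finite I" "j \<in> I"
  shows "AE x in cube_measure I. x j \<noteq> 0"
proof -
  define J where "J = I - {j}"
  have J: "I = insert j J" "finite J" "j \<notin> J" using assms by (auto simp: J_def)
  have m: "(\<lambda>x. x j) \<in> measurable (\<Pi>\<^sub>M i\<in>I. lborel) (lborel :: real measure)"
    by (rule measurable_component_singleton) simp
  define h where "h x = (indicator {0} (x j) :: ennreal)" for x :: "nat \<Rightarrow> real"
  have [measurable]: "h \<in> borel_measurable (\<Pi>\<^sub>M i\<in>insert j J. lborel)"
    unfolding h_def J(1)[symmetric] using m by measurable
  have "(\<integral>\<^sup>+x. h x \<partial>(\<Pi>\<^sub>M i\<in>I. lborel)) =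
      (\<integral>\<^sup>+z. (\<integral>\<^sup>+t. indicator {0} t \<partial>(lborel :: real measure)) \<partial>(\<Pi>\<^sub>M i\<in>J. (lborel :: real measure)))"
    unfolding J(1) by (subst lborel_product.product_nn_integral_insert) (auto simp: J h_def)
  then have "(\<integral>\<^sup>+x. h x \<partial>(\<Pi>\<^sub>M i\<in>I. lborel)) = 0"
    by simp
  then have "AE x in (\<Pi>\<^sub>M i\<in>I. lborel). h x = 0"
    by (subst (asm) nn_integral_0_iff_AE) (auto simp: J(1))
  then show ?thesis
    unfolding AE_cube_iff[OF I(1)] by eventually_elim (auto simp: h_def indicator_def split: if_splits)
qed

lemma cube_measure_in_sets_AE:
  assumes "finite I" "AE x in cube_measure I. x \<in> A \<longleftrightarrow> x \<in> B"
    and "A \<in> sets (cube_measure I)" "B \<subseteq> cube I"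
  shows "B \<in> sets (cube_measure I)"
proof -
  let ?C = "completion (\<Pi>\<^sub>M i\<in>I. (lborel :: real measure))"
  have c: "cube I \<in> sets ?C" using assms(1) by auto
  have A: "A \<in> sets ?C" "A \<subseteq> cube I"
    using assms(3) c unfolding cube_measure_def by (auto simp: sets_restrict_space)
  have "AE x in ?C. x \<in> cube I \<longrightarrow> (x \<in> A \<longleftrightarrow> x \<in> B)"
    using assms(2) unfolding AE_cube_iff[OF assms(1)] AE_completion_iff .
  then have "AE x in ?C. x \<in> A \<longleftrightarrow> x \<in> B"
    by eventually_elim (use A assms(4) in auto)
  from completion.in_sets_AE[OF this A(1)] have "B \<in> sets ?C"
    using assms(4) sets.sets_into_space[OF c] by auto
  then show ?thesis
    using assms(4) unfolding cube_measure_def sets_restrict_space by (intro image_eqI[of _ _ B]) auto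
qed

text \<open>Completeness of Lebesgue measure. The error of a rearranged function inherits
  measurability in this way from its Borel version, as \<open>esssup_I\<close> requires.\<close>

lemma measurable_cube_AE_cong:
  assumes "finite I" and g: "g \<in> measurable (cube_measure I) N"
    and ae: "AE x in cube_measure I. f x = g x" and sp: "f \<in> cube I \<rightarrow> space N"
  shows "f \<in> measurable (cube_measure I) N"
proof (rule measurableI)
  fix S assume S: "S \<in> sets N"
  show "f -` S \<inter> space (cube_measure I) \<in> sets (cube_measure I)"
  proof (rule cube_measure_in_sets_AE[OF \<open>finite I\<close>])
    show "g -` S \<inter> space (cube_measure I) \<in> sets (cube_measure I)"
      using g S by (rule measurable_sets)
    show "AE x in cube_measure I. x \<in> g -` S \<inter> space (cube_measure I) \<longleftrightarrow> x \<in> f -` S \<inter> space (cube_measure I)"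
      using ae by eventually_elim auto
  qed auto
qed (use sp in auto)

text \<open>The completion supplies a Borel function equal to \<open>f\<close> almost everywhere.
  Resetting its values outside the closed, hence Borel, set \<open>C\<close> to a point of
  \<open>C\<close> makes the range condition hold everywhere.\<close>

lemma cube_measure_borel_version:
  fixes f :: "(nat \<Rightarrow> real) \<Rightarrow> real"
  assumes "finite I" and f: "f \<in> borel_measurable (cube_measure I)" and fC: "f \<in> cube I \<rightarrow> C"
    and C: "closed C" "C \<noteq> {}"
  obtains g where "g \<in> borel_measurable (\<Pi>\<^sub>M i\<in>I. lborel)" "range g \<subseteq> C"
    "AE x in cube_measure I. f x = g x"
proof -
  obtain k where k: "k \<in> C" using C by auto
  let ?P = "\<Pi>\<^sub>M i\<in>I. (lborel :: real measure)"
  have "(\<lambda>x. if x \<in> cube I then f x else k) \<in> borel_measurable (completion ?P)"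
  proof (rule measurable_If_restrict_space_iff[THEN iffD2])
    show "f \<in> borel_measurable (restrict_space (completion ?P) {x. x \<in> cube I}) \<and>
      (\<lambda>x. k) \<in> borel_measurable (restrict_space (completion ?P) {x. x \<notin> cube I})"
      using f unfolding cube_measure_def by auto
    show "{x \<in> space (completion ?P). x \<in> cube I} \<in> sets (completion ?P)"
      using cube_sets_completion[OF assms(1)] by (simp add: Int_def conj_commute)
  qed
  from completion_ex_borel_measurable_real[OF this]
  obtain g where [measurable]: "g \<in> borel_measurable ?P"
    and g: "AE x in ?P. (if x \<in> cube I then f x else k) = g x" by blast
  show ?thesis
  proof
    have "C \<in> sets borel" using C by auto
    then show "(\<lambda>x. if g x \<in> C then g x else k) \<in> borel_measurable ?P"
      by measurable
    show "range (\<lambda>x. if g x \<in> C then g x else k) \<subseteq> C" using k by auto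
    show "AE x in cube_measure I. f x = (if g x \<in> C then g x else k)"
      unfolding AE_cube_iff[OF assms(1)] using g
      by eventually_elim (use fC in \<open>metis PiE\<close>)
  qed
qed

section \<open>One-dimensional rearrangement\<close>

abbreviation unit_interval :: "real measure" where
  "unit_interval \<equiv> lebesgue_on {0..1}"

lemma prob_space_unit_interval: "prob_space unit_interval"
  by (rule prob_spaceI) (simp add: emeasure_restrict_space)

interpretation unit_interval: prob_space unit_interval
  by (rule prob_space_unit_interval)

text \<open>Convexity enters as a monotone slope whose integral recovers \<open>c\<close>, which
  admits kinks such as those of \<open>max 0 (\<bar>u\<bar> - M)\<close>. Right continuity lets
  \<open>interval_measure \<phi>\<close> give \<open>{a<..b}\<close> the mass
  \<open>\<phi> b - \<phi> a\<close>.\<close>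

locale convex_cost =
  fixes c \<phi> :: "real \<Rightarrow> real"
  assumes cost_nonneg: "0 \<le> c x"
    and cost_cont: "continuous_on UNIV c"
    and slope_mono: "x \<le> y \<Longrightarrow> \<phi> x \<le> \<phi> y"
    and slope_right_cont: "continuous (at_right x) \<phi>"
    and slope_integral: "a \<le> b \<Longrightarrow> (\<phi> has_integral (c b - c a)) {a..b}"
begin

text \<open>A pair \<open>(w, u)\<close> stands for the level \<open>w\<close> of \<open>g\<close>
  and the level \<open>u + w\<close> of \<open>f\<close>. This shear turns the measure
  \<open>d\<phi>(y - w) dw\<close> into a product measure.\<close>

definition levels :: "(real \<times> real) measure" where
  "levels = lborel \<Otimes>\<^sub>M interval_measure \<phi>"

sublocale slope: sigma_finite_measure "interval_measure \<phi>"
  by (rule sigma_finite_interval_measure[OF slope_mono slope_right_cont])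

sublocale slope_pair: pair_sigma_finite lborel "interval_measure \<phi>"
  by standard

sublocale levels: sigma_finite_measure levels
  unfolding levels_def by (rule slope_pair.P.sigma_finite_measure_axioms)

lemma sets_levels [measurable_cong]: "sets levels = sets (borel \<Otimes>\<^sub>M borel)"
  unfolding levels_def by (intro sets_pair_measure_cong) auto

lemma space_levels [simp]: "space levels = UNIV"
  unfolding levels_def by (simp add: space_pair_measure)

lemma cost_measurable [measurable]: "c \<in> borel_measurable borel"
  using cost_cont by (rule borel_measurable_continuous_onI)

lemma slope_integral_reflected:
  assumes "t \<le> t'"
  shows "((\<lambda>w. \<phi> (v - w)) has_integral (c (v - t) - c (v - t'))) {t..t'}"
proof -
  have "((\<lambda>w. \<phi> (-1 *\<^sub>R w + v)) has_integral (1 / \<bar>-1\<bar> ^ DIM(real)) *\<^sub>R (c (v - t) - c (v - t')))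
     ((\<lambda>x. (1 / -1) *\<^sub>R x + - ((1 / -1) *\<^sub>R v)) ` cbox (v - t') (v - t))"
    using slope_integral[of "v - t'" "v - t"] assms
    by (intro has_integral_affinity) auto
  moreover have "(\<lambda>x. (1 / -1) *\<^sub>R x + - ((1 / -1) *\<^sub>R v)) ` cbox (v - t') (v - t) = {t..t'}"
  proof -
    have "x \<in> (\<lambda>x. v - x) ` {v - t'..v - t}" if "x \<in> {t..t'}" for x
      using that by (intro image_eqI[of _ _ "v - x"]) auto
    then show ?thesis by auto
  qed
  ultimately show ?thesis by (simp add: algebra_simps)
qed

text \<open>For fixed \<open>w\<close> the section in \<open>u\<close> is
  \<open>{v - w<..v' - w}\<close>, of mass \<open>\<phi> (v' - w) - \<phi> (v - w)\<close>, and
  \<open>\<phi>\<close> integrates to \<open>c\<close>. The half-open sides match the super-level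
  sets \<open>{w < g}\<close> and \<open>{y \<le> f}\<close> used later.\<close>

lemma emeasure_levels_rectangle:
  assumes "v \<le> v'" "t \<le> t'"
  shows "emeasure levels {(w, u). t \<le> w \<and> w < t' \<and> v < u + w \<and> u + w \<le> v'} =
     ennreal (c (v - t') + c (v' - t) - c (v - t) - c (v' - t'))" (is "emeasure _ ?R = _")
proof -
  have "{p \<in> space (borel \<Otimes>\<^sub>M borel). t \<le> fst p \<and> fst p < t' \<and> v < snd p + fst p \<and> snd p + fst p \<le> v'}
     \<in> sets (borel \<Otimes>\<^sub>M (borel :: real measure))"
    by measurable
  also have "{p \<in> space (borel \<Otimes>\<^sub>M borel). t \<le> fst p \<and> fst p < t' \<and> v < snd p + fst p \<and> snd p + fst p \<le> v'} = ?R"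
    by (auto simp: space_pair_measure)
  finally have R: "?R \<in> sets (lborel \<Otimes>\<^sub>M interval_measure \<phi>)"
    using sets_levels unfolding levels_def by simp
  have *: "emeasure (interval_measure \<phi>) (Pair w -` ?R) =
      ennreal (\<phi> (v' - w) - \<phi> (v - w)) * indicator {t..<t'} w" for w
  proof (cases "w \<in> {t..<t'}")
    case True
    then have "Pair w -` ?R = {v - w<..v' - w}" by auto
    then show ?thesis
      using True assms(1) by (simp add: emeasure_interval_measure_Ioc[OF _ slope_mono slope_right_cont])
  next
    case False
    then have e: "Pair w -` ?R = {}" by auto
    show ?thesis unfolding e using False by simp
  qed
  have "emeasure levels ?R = (\<integral>\<^sup>+w. ennreal (\<phi> (v' - w) - \<phi> (v - w)) * indicator {t..<t'} w \<partial>lborel)"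
    unfolding levels_def by (subst slope.emeasure_pair_measure_alt[OF R]) (simp only: *)
  \<comment> \<open>Adding the null endpoint \<open>t'\<close> gives the closed interval on which
    the slope is integrated.\<close>
  also have "\<dots> = (\<integral>\<^sup>+w. ennreal (\<phi> (v' - w) - \<phi> (v - w)) * indicator {t..t'} w \<partial>lborel)"
  proof (rule nn_integral_cong_AE)
    have "AE w in lborel. w \<noteq> t'"
      by (rule AE_lborel_singleton)
    then show "AE w in lborel. ennreal (\<phi> (v' - w) - \<phi> (v - w)) * indicator {t..<t'} w =
        ennreal (\<phi> (v' - w) - \<phi> (v - w)) * indicator {t..t'} w"
      by eventually_elim (auto simp: indicator_def)
  qed
  also have "\<dots> = ennreal ((c (v' - t) - c (v' - t')) - (c (v - t) - c (v - t')))"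
    using assms slope_mono
    by (intro nn_integral_has_integral_lebesgue' has_integral_diff slope_integral_reflected) auto
  finally show ?thesis by (simp add: algebra_simps)
qed

end

text \<open>The deficit of a level pair is a minimum of two measures. A product can be integrated
  over the levels by Tonelli, so the minimum is traded for a product. For \<open>M = 0\<close> the
  convention \<open>1 / 0 = 0\<close> makes the left side vanish.\<close>

lemma mult_divide_le_min:
  fixes a b M :: real
  assumes "0 \<le> a" "0 \<le> b" "a \<le> M" "b \<le> M"
  shows "1 / M * (a * b) \<le> min a b"
proof (cases "M = 0")
  case False
  then have M: "M > 0" using assms by auto
  have "a * b \<le> a * M" "a * b \<le> M * b"
    using assms by (auto intro: mult_left_mono mult_right_mono)
  then show ?thesis using M by (simp add: field_simps)
qed (use assms in auto)

section \<open>Layer-cake formula and the exchange gain on a single slice\<close>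

context convex_cost
begin

lemma level_sets_measurable:
  assumes [measurable]: "f \<in> borel_measurable unit_interval" "g \<in> borel_measurable unit_interval"
  shows "{(x, w, u). x \<in> {0..1} \<and> lo \<le> w \<and> w < g x \<and> lo < u + w \<and> u + w \<le> f x}
    \<in> sets (unit_interval \<Otimes>\<^sub>M levels)"
proof -
  have "{p \<in> space (unit_interval \<Otimes>\<^sub>M levels). lo \<le> fst (snd p) \<and> fst (snd p) < g (fst p) \<and>
      lo < snd (snd p) + fst (snd p) \<and> snd (snd p) + fst (snd p) \<le> f (fst p)} \<in> sets (unit_interval \<Otimes>\<^sub>M levels)"
    by measurable
  also have "{p \<in> space (unit_interval \<Otimes>\<^sub>M levels). lo \<le> fst (snd p) \<and> fst (snd p) < g (fst p) \<and>
      lo < snd (snd p) + fst (snd p) \<and> snd (snd p) + fst (snd p) \<le> f (fst p)} =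
     {(x, w, u). x \<in> {0..1} \<and> lo \<le> w \<and> w < g x \<and> lo < u + w \<and> u + w \<le> f x}"
    by (auto simp: space_pair_measure)
  finally show ?thesis .
qed

text \<open>
  The quantity \<open>c (lo - g x) + c (f x - lo) - c 0 - c (f x - g x)\<close>, integrated over \<open>x\<close>, written as an
  integral over the levels \<open>w\<close> of \<open>g\<close> and \<open>u + w\<close> of \<open>f\<close>.
\<close>

definition layer :: "real \<Rightarrow> (real \<Rightarrow> real) \<Rightarrow> (real \<Rightarrow> real) \<Rightarrow> real \<times> real \<Rightarrow> ennreal" where
  "layer lo f g = (\<lambda>(w, u). if lo \<le> w \<and> lo < u + w
     then emeasure unit_interval {x \<in> {0..1}. w < g x \<and> u + w \<le> f x} else 0)"

text \<open>Tonelli for the set \<open>?Q\<close> of triples \<open>(x, w, u)\<close>: its sections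
  at a level pair give \<open>layer\<close>, its sections at \<open>x\<close> are rectangles with
  lower corner \<open>(lo, lo)\<close>. The negative terms of the double difference are moved to the
  left side.\<close>

lemma layer_cake:
  assumes [measurable]: "f \<in> borel_measurable unit_interval" "g \<in> borel_measurable unit_interval"
    and lo: "\<And>x. x \<in> {0..1} \<Longrightarrow> lo \<le> f x" "\<And>x. x \<in> {0..1} \<Longrightarrow> lo \<le> g x"
  shows "layer lo f g \<in> borel_measurable levels"
    and "(\<integral>\<^sup>+x. c (f x - g x) \<partial>unit_interval) + (\<integral>\<^sup>+p. layer lo f g p \<partial>levels) + ennreal (c 0) =
      (\<integral>\<^sup>+x. c (lo - g x) \<partial>unit_interval) + (\<integral>\<^sup>+x. c (f x - lo) \<partial>unit_interval)"
proof -
  let ?Q = "{(x, w, u). x \<in> {0..1} \<and> lo \<le> w \<and> w < g x \<and> lo < u + w \<and> u + w \<le> f x}"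
  interpret P: pair_sigma_finite unit_interval levels ..
  have Q: "?Q \<in> sets (unit_interval \<Otimes>\<^sub>M levels)"
    by (rule level_sets_measurable) measurable
  have layer: "layer lo f g p = emeasure unit_interval ((\<lambda>x. (x, p)) -` ?Q)" for p
  proof -
    obtain w u where p: "p = (w, u)" by (cases p)
    show ?thesis
    proof (cases "lo \<le> w \<and> lo < u + w")
      case True
      then have "(\<lambda>x. (x, p)) -` ?Q = {x \<in> {0..1}. w < g x \<and> u + w \<le> f x}" using p by auto
      then show ?thesis using True p by (simp add: layer_def)
    next
      case False
      then have "(\<lambda>x. (x, p)) -` ?Q = {}" using p by auto
      then show ?thesis using False p by (auto simp: layer_def)
    qed
  qed
  show "layer lo f g \<in> borel_measurable levels"
    unfolding layer using P.measurable_emeasure_Pair2[OF Q] by simp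
  have "(\<integral>\<^sup>+p. layer lo f g p \<partial>levels) = emeasure (unit_interval \<Otimes>\<^sub>M levels) ?Q"
    unfolding layer by (rule P.emeasure_pair_measure_alt2[OF Q, symmetric])
  also have "\<dots> = (\<integral>\<^sup>+x. emeasure levels (Pair x -` ?Q) \<partial>unit_interval)"
    by (rule levels.emeasure_pair_measure_alt[OF Q])
  also have "\<dots> = (\<integral>\<^sup>+x. ennreal (c (lo - g x) + c (f x - lo) - c 0 - c (f x - g x)) \<partial>unit_interval)"
  proof (rule nn_integral_cong)
    fix x assume "x \<in> space unit_interval"
    then have x: "x \<in> {0..1}" by simp
    then have "Pair x -` ?Q = {(w, u). lo \<le> w \<and> w < g x \<and> lo < u + w \<and> u + w \<le> f x}" by auto
    with emeasure_levels_rectangle[OF lo(1)[OF x] lo(2)[OF x]]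
    show "emeasure levels (Pair x -` ?Q) = ennreal (c (lo - g x) + c (f x - lo) - c 0 - c (f x - g x))"
      by simp
  qed
  finally have eq: "(\<integral>\<^sup>+p. layer lo f g p \<partial>levels) =
      (\<integral>\<^sup>+x. ennreal (c (lo - g x) + c (f x - lo) - c 0 - c (f x - g x)) \<partial>unit_interval)" .
  have "(\<integral>\<^sup>+x. c (f x - g x) \<partial>unit_interval) + (\<integral>\<^sup>+p. layer lo f g p \<partial>levels) + ennreal (c 0) =
     (\<integral>\<^sup>+x. (ennreal (c (f x - g x)) + ennreal (c (lo - g x) + c (f x - lo) - c 0 - c (f x - g x))) + ennreal (c 0)
        \<partial>unit_interval)"
    unfolding eq by (simp add: nn_integral_add unit_interval.emeasure_space_1[simplified])
  also have "\<dots> = (\<integral>\<^sup>+x. ennreal (c (lo - g x)) + ennreal (c (f x - lo)) \<partial>unit_interval)"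
  proof (rule nn_integral_cong)
    fix x assume "x \<in> space unit_interval"
    then have x: "x \<in> {0..1}" by simp
    \<comment> \<open>The double difference has to be nonnegative for its \<open>ennreal\<close>
      image to be faithful; it is the integral of a slope increment over
      \<open>{lo..g x}\<close>.\<close>
    have "0 \<le> c (lo - g x) + c (f x - lo) - c 0 - c (f x - g x)"
    proof -
      have "((\<lambda>w. \<phi> (f x - w) - \<phi> (lo - w)) has_integral
        ((c (f x - lo) - c (f x - g x)) - (c (lo - lo) - c (lo - g x)))) {lo..g x}"
        using lo x by (intro has_integral_diff slope_integral_reflected) auto
      moreover have "0 \<le> \<phi> (f x - w) - \<phi> (lo - w)" for w
        using lo(1)[OF x] slope_mono by auto
      ultimately have "0 \<le> (c (f x - lo) - c (f x - g x)) - (c (lo - lo) - c (lo - g x))"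
        using has_integral_nonneg by blast
      then show ?thesis by simp
    qed
    moreover from this have "0 \<le> c (lo - g x) + c (f x - lo) - c 0"
      using cost_nonneg[of "f x - g x"] by linarith
    ultimately show "(ennreal (c (f x - g x)) + ennreal (c (lo - g x) + c (f x - lo) - c 0 - c (f x - g x))) + ennreal (c 0)
      = ennreal (c (lo - g x)) + ennreal (c (f x - lo))"
      by (simp add: cost_nonneg ennreal_plus[symmetric] del: ennreal_plus)
  qed
  also have "\<dots> = (\<integral>\<^sup>+x. c (lo - g x) \<partial>unit_interval) + (\<integral>\<^sup>+x. c (f x - lo) \<partial>unit_interval)"
    by (rule nn_integral_add) auto
  finally show "(\<integral>\<^sup>+x. c (f x - g x) \<partial>unit_interval) + (\<integral>\<^sup>+p. layer lo f g p \<partial>levels) + ennreal (c 0) =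
      (\<integral>\<^sup>+x. c (lo - g x) \<partial>unit_interval) + (\<integral>\<^sup>+x. c (f x - lo) \<partial>unit_interval)" .
qed

text \<open>Tonelli for triples \<open>(s, t, p)\<close>. At a fixed level pair the condition splits
  into one on \<open>s\<close> and one on \<open>t\<close>, so the section is a product set of
  measure \<open>a p * b p\<close>; at a fixed pair \<open>(s, t)\<close> it is a rectangle of mass
  at least \<open>\<kappa>\<close>.\<close>

lemma exchange_integral:
  assumes [measurable]: "f \<in> borel_measurable unit_interval" "g \<in> borel_measurable unit_interval"
    and [measurable]: "A \<in> sets unit_interval" "A' \<in> sets unit_interval"
    and gain: "\<And>s t. s \<in> A \<Longrightarrow> t \<in> A' \<Longrightarrow> f t \<le> f s \<and> g s \<le> g t \<and>
       \<kappa> \<le> c (f t - g t) + c (f s - g s) - c (f t - g s) - c (f s - g t)"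
  defines "a \<equiv> \<lambda>(w, u). emeasure unit_interval {s \<in> A. g s \<le> w \<and> u + w \<le> f s}"
    and "b \<equiv> \<lambda>(w, u). emeasure unit_interval {t \<in> A'. w < g t \<and> f t < u + w}"
  shows "(\<lambda>p. a p * b p) \<in> borel_measurable levels"
    and "ennreal \<kappa> * (emeasure unit_interval A * emeasure unit_interval A') \<le> (\<integral>\<^sup>+p. a p * b p \<partial>levels)"
proof -
  interpret UU: pair_sigma_finite unit_interval unit_interval ..
  interpret UUL: pair_sigma_finite "unit_interval \<Otimes>\<^sub>M unit_interval" levels ..
  let ?Q = "{p \<in> space ((unit_interval \<Otimes>\<^sub>M unit_interval) \<Otimes>\<^sub>M levels).
     fst (fst p) \<in> A \<and> g (fst (fst p)) \<le> fst (snd p) \<and> snd (snd p) + fst (snd p) \<le> f (fst (fst p)) \<and>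
     snd (fst p) \<in> A' \<and> fst (snd p) < g (snd (fst p)) \<and> f (snd (fst p)) < snd (snd p) + fst (snd p)}"
  have Q: "?Q \<in> sets ((unit_interval \<Otimes>\<^sub>M unit_interval) \<Otimes>\<^sub>M levels)"
    by measurable
  have sub: "A \<subseteq> {0..1}" "A' \<subseteq> {0..1}"
    using assms(3,4)[THEN sets.sets_into_space] by auto
  have ab: "a p * b p = emeasure (unit_interval \<Otimes>\<^sub>M unit_interval) ((\<lambda>x. (x, p)) -` ?Q)" for p
  proof -
    obtain w u where p: "p = (w, u)" by (cases p)
    have "{s \<in> space unit_interval. s \<in> A \<and> g s \<le> w \<and> u + w \<le> f s} \<in> sets unit_interval"
      "{t \<in> space unit_interval. t \<in> A' \<and> w < g t \<and> f t < u + w} \<in> sets unit_interval"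
      by measurable
    moreover have "{s \<in> space unit_interval. s \<in> A \<and> g s \<le> w \<and> u + w \<le> f s} = {s \<in> A. g s \<le> w \<and> u + w \<le> f s}"
      "{t \<in> space unit_interval. t \<in> A' \<and> w < g t \<and> f t < u + w} = {t \<in> A'. w < g t \<and> f t < u + w}"
      using sub by auto
    ultimately have "emeasure (unit_interval \<Otimes>\<^sub>M unit_interval)
      ({s \<in> A. g s \<le> w \<and> u + w \<le> f s} \<times> {t \<in> A'. w < g t \<and> f t < u + w}) = a p * b p"
      using p by (simp add: a_def b_def unit_interval.emeasure_pair_measure_Times)
    moreover have "(\<lambda>x. (x, p)) -` ?Q = {s \<in> A. g s \<le> w \<and> u + w \<le> f s} \<times> {t \<in> A'. w < g t \<and> f t < u + w}"
      using p sub by (auto simp: space_pair_measure)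
    ultimately show ?thesis by simp
  qed
  show "(\<lambda>p. a p * b p) \<in> borel_measurable levels"
    unfolding ab by (rule UUL.measurable_emeasure_Pair2[OF Q])
  have "ennreal \<kappa> * (emeasure unit_interval A * emeasure unit_interval A') =
     (\<integral>\<^sup>+q. ennreal \<kappa> * indicator (A \<times> A') q \<partial>(unit_interval \<Otimes>\<^sub>M unit_interval))"
    by (simp add: nn_integral_cmult_indicator unit_interval.emeasure_pair_measure_Times)
  also have "\<dots> \<le> (\<integral>\<^sup>+q. emeasure levels (Pair q -` ?Q) \<partial>(unit_interval \<Otimes>\<^sub>M unit_interval))"
  proof (rule nn_integral_mono)
    fix q assume "q \<in> space (unit_interval \<Otimes>\<^sub>M unit_interval)"
    show "ennreal \<kappa> * indicator (A \<times> A') q \<le> emeasure levels (Pair q -` ?Q)"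
    proof (cases "q \<in> A \<times> A'")
      case True
      then obtain s t where q: "q = (s, t)" "s \<in> A" "t \<in> A'" by auto
      have "Pair q -` ?Q = {(w, u). g s \<le> w \<and> w < g t \<and> f t < u + w \<and> u + w \<le> f s}"
        using q sub by (auto simp: space_pair_measure)
      with emeasure_levels_rectangle[of "f t" "f s" "g s" "g t"] gain[OF q(2,3)] q
      show ?thesis by (simp add: ennreal_leI)
    qed simp
  qed
  also have "\<dots> = emeasure ((unit_interval \<Otimes>\<^sub>M unit_interval) \<Otimes>\<^sub>M levels) ?Q"
    by (rule levels.emeasure_pair_measure_alt[OF Q, symmetric])
  also have "\<dots> = (\<integral>\<^sup>+p. a p * b p \<partial>levels)"
    unfolding ab by (rule UUL.emeasure_pair_measure_alt2[OF Q])
  finally show "ennreal \<kappa> * (emeasure unit_interval A * emeasure unit_interval A') \<le> (\<integral>\<^sup>+p. a p * b p \<partial>levels)" .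
qed

text \<open>The estimate is made for each level pair separately. With \<open>y = u + w\<close>, the
  sets measured by \<open>a\<close> and \<open>b\<close> lie in the two deficit sets
  \<open>{f \<ge> y, g \<le> w}\<close> and \<open>{f < y, g > w}\<close>.\<close>

lemma layer_gain:
  assumes [measurable]: "f \<in> borel_measurable unit_interval" "fs \<in> borel_measurable unit_interval"
      "g \<in> borel_measurable unit_interval" "A \<in> sets unit_interval" "A' \<in> sets unit_interval"
    and distr: "distr unit_interval borel fs = distr unit_interval borel f"
    and mono: "mono_on {0..1} fs" "mono_on {0..1} g"
    and lo: "\<And>x. x \<in> {0..1} \<Longrightarrow> lo \<le> f x" "\<And>x. x \<in> {0..1} \<Longrightarrow> lo \<le> g x"
  defines "a \<equiv> \<lambda>(w, u). emeasure unit_interval {s \<in> A. g s \<le> w \<and> u + w \<le> f s}"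
    and "b \<equiv> \<lambda>(w, u). emeasure unit_interval {t \<in> A'. w < g t \<and> f t < u + w}"
    and "M \<equiv> max (measure unit_interval A) (measure unit_interval A')"
  shows "layer lo f g p + ennreal (1 / M) * (a p * b p) \<le> layer lo fs g p"
proof -
  obtain w u where p: "p = (w, u)" by (cases p)
  define y where "y = u + w"
  have sub: "A \<subseteq> {0..1}" "A' \<subseteq> {0..1}"
    using assms(4,5)[THEN sets.sets_into_space] by auto
  let ?m = "measure unit_interval"
  have mA: "{s \<in> A. g s \<le> w \<and> y \<le> f s} \<in> sets unit_interval" "{t \<in> A'. w < g t \<and> f t < y} \<in> sets unit_interval"
  proof -
    have "{s \<in> space unit_interval. s \<in> A \<and> g s \<le> w \<and> y \<le> f s} \<in> sets unit_interval"
      "{t \<in> space unit_interval. t \<in> A' \<and> w < g t \<and> f t < y} \<in> sets unit_interval"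
      by measurable
    moreover have "{s \<in> space unit_interval. s \<in> A \<and> g s \<le> w \<and> y \<le> f s} = {s \<in> A. g s \<le> w \<and> y \<le> f s}"
      "{t \<in> space unit_interval. t \<in> A' \<and> w < g t \<and> f t < y} = {t \<in> A'. w < g t \<and> f t < y}"
      using sub by auto
    ultimately show "{s \<in> A. g s \<le> w \<and> y \<le> f s} \<in> sets unit_interval" "{t \<in> A'. w < g t \<and> f t < y} \<in> sets unit_interval"
      by auto
  qed
  have "{x \<in> space unit_interval. w < g x \<and> y \<le> f x} \<in> sets unit_interval"
      "{x \<in> space unit_interval. w < g x \<and> f x < y} \<in> sets unit_interval"
      "{x \<in> space unit_interval. g x \<le> w \<and> y \<le> f x} \<in> sets unit_interval"
      "{x \<in> space unit_interval. w < g x \<and> y \<le> fs x} \<in> sets unit_interval"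
      "{x \<in> space unit_interval. w < g x} \<in> sets unit_interval"
      "{x \<in> space unit_interval. y \<le> f x} \<in> sets unit_interval"
      "{x \<in> space unit_interval. y \<le> fs x} \<in> sets unit_interval"
    by measurable
  then have S: "{x \<in> {0..1}. w < g x \<and> y \<le> f x} \<in> sets unit_interval"
      "{x \<in> {0..1}. w < g x \<and> f x < y} \<in> sets unit_interval"
      "{x \<in> {0..1}. g x \<le> w \<and> y \<le> f x} \<in> sets unit_interval"
      "{x \<in> {0..1}. w < g x \<and> y \<le> fs x} \<in> sets unit_interval"
      "{x \<in> {0..1}. w < g x} \<in> sets unit_interval"
      "{x \<in> {0..1}. y \<le> f x} \<in> sets unit_interval"
      "{x \<in> {0..1}. y \<le> fs x} \<in> sets unit_interval"
    by simp_all
  have eqd: "?m {x \<in> {0..1}. y \<le> fs x} = ?m {x \<in> {0..1}. y \<le> f x}"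
  proof -
    have "measure (distr unit_interval borel fs) {y..} = measure (distr unit_interval borel f) {y..}"
      by (simp add: distr)
    then show ?thesis
      by (simp add: measure_distr vimage_def Int_def conj_commute)
  qed
  \<comment> \<open>The common part together with either deficit set is one of the marginals
    \<open>{f \<ge> y}\<close> and \<open>{g > w}\<close>, and adding a constant commutes with
    \<open>min\<close>.\<close>
  have "?m {x \<in> {0..1}. w < g x \<and> y \<le> f x} + min (?m {x \<in> {0..1}. g x \<le> w \<and> y \<le> f x}) (?m {x \<in> {0..1}. w < g x \<and> f x < y})
    = min (?m {x \<in> {0..1}. y \<le> f x}) (?m {x \<in> {0..1}. w < g x})"
  proof -
    have "?m {x \<in> {0..1}. w < g x \<and> y \<le> f x} + ?m {x \<in> {0..1}. g x \<le> w \<and> y \<le> f x} =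
      ?m ({x \<in> {0..1}. w < g x \<and> y \<le> f x} \<union> {x \<in> {0..1}. g x \<le> w \<and> y \<le> f x})"
      by (rule unit_interval.finite_measure_Union[symmetric]) (use S in auto)
    moreover have "{x \<in> {0..1}. w < g x \<and> y \<le> f x} \<union> {x \<in> {0..1}. g x \<le> w \<and> y \<le> f x} = {x \<in> {0..1}. y \<le> f x}"
      by auto
    moreover have "?m {x \<in> {0..1}. w < g x \<and> y \<le> f x} + ?m {x \<in> {0..1}. w < g x \<and> f x < y} =
      ?m ({x \<in> {0..1}. w < g x \<and> y \<le> f x} \<union> {x \<in> {0..1}. w < g x \<and> f x < y})"
      by (rule unit_interval.finite_measure_Union[symmetric]) (use S in auto)
    moreover have "{x \<in> {0..1}. w < g x \<and> y \<le> f x} \<union> {x \<in> {0..1}. w < g x \<and> f x < y} = {x \<in> {0..1}. w < g x}"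
      by auto
    ultimately show ?thesis by (simp add: min_def)
  qed
  also have "\<dots> = min (?m {x \<in> {0..1}. y \<le> fs x}) (?m {x \<in> {0..1}. w < g x})"
    by (simp only: eqd)
  also have "\<dots> \<le> ?m {x \<in> {0..1}. w < g x \<and> y \<le> fs x}"
  proof -
    \<comment> \<open>super-level sets of two increasing functions are nested\<close>
    have "{x \<in> {0..1}. y \<le> fs x} \<subseteq> {x \<in> {0..1}. w < g x} \<or> {x \<in> {0..1}. w < g x} \<subseteq> {x \<in> {0..1}. y \<le> fs x}"
    proof (rule ccontr)
      assume "\<not> ?thesis"
      then obtain r r' where r: "r \<in> {0..1}" "y \<le> fs r" "\<not> w < g r" "r' \<in> {0..1}" "w < g r'" "\<not> y \<le> fs r'"
        by auto
      show False
      proof (cases "r \<le> r'")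
        case True
        then show False using mono_onD[OF mono(1), of r r'] r by auto
      next
        case False
        then show False using mono_onD[OF mono(2), of r' r] r by auto
      qed
    qed
    then show ?thesis
    proof
      assume "{x \<in> {0..1}. y \<le> fs x} \<subseteq> {x \<in> {0..1}. w < g x}"
      then have "{x \<in> {0..1}. w < g x \<and> y \<le> fs x} = {x \<in> {0..1}. y \<le> fs x}" by auto
      then show ?thesis by simp
    next
      assume "{x \<in> {0..1}. w < g x} \<subseteq> {x \<in> {0..1}. y \<le> fs x}"
      then have "{x \<in> {0..1}. w < g x \<and> y \<le> fs x} = {x \<in> {0..1}. w < g x}" by auto
      then show ?thesis by simp
    qed
  qed
  finally have main: "?m {x \<in> {0..1}. w < g x \<and> y \<le> f x} +
      min (?m {x \<in> {0..1}. g x \<le> w \<and> y \<le> f x}) (?m {x \<in> {0..1}. w < g x \<and> f x < y})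
    \<le> ?m {x \<in> {0..1}. w < g x \<and> y \<le> fs x}" .
  let ?a = "?m {s \<in> A. g s \<le> w \<and> y \<le> f s}" and ?b = "?m {t \<in> A'. w < g t \<and> f t < y}"
  have le: "?a \<le> ?m A" "?b \<le> ?m A'"
    by (rule unit_interval.finite_measure_mono; auto)+
  have "1 / M * (?a * ?b) \<le> min ?a ?b"
    using le by (intro mult_divide_le_min) (auto simp: M_def)
  also have "\<dots> \<le> min (?m {x \<in> {0..1}. g x \<le> w \<and> y \<le> f x}) (?m {x \<in> {0..1}. w < g x \<and> f x < y})"
    by (intro min.mono unit_interval.finite_measure_mono S) (use sub in auto)
  finally have real: "?m {x \<in> {0..1}. w < g x \<and> y \<le> f x} + 1 / M * (?a * ?b) \<le> ?m {x \<in> {0..1}. w < g x \<and> y \<le> fs x}"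
    using main by linarith
  have M0: "0 \<le> M" by (simp add: M_def le_max_iff_disj)
  have ab: "ennreal (1 / M) * (a p * b p) = ennreal (1 / M * (?a * ?b))"
    using M0 by (simp add: p a_def b_def unit_interval.emeasure_eq_measure y_def ennreal_mult[symmetric])
  show ?thesis
  proof (cases "lo \<le> w \<and> lo < y")
    case True
    then have "layer lo f g p = ennreal (?m {x \<in> {0..1}. w < g x \<and> y \<le> f x})"
      "layer lo fs g p = ennreal (?m {x \<in> {0..1}. w < g x \<and> y \<le> fs x})"
      by (simp_all add: layer_def p y_def unit_interval.emeasure_eq_measure)
    moreover have "ennreal (?m {x \<in> {0..1}. w < g x \<and> y \<le> f x}) + ennreal (1 / M * (?a * ?b)) =
        ennreal (?m {x \<in> {0..1}. w < g x \<and> y \<le> f x} + 1 / M * (?a * ?b))"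
      using M0 by (intro ennreal_plus[symmetric] mult_nonneg_nonneg divide_nonneg_nonneg measure_nonneg) auto
    ultimately show ?thesis
      unfolding ab using ennreal_leI[OF real] by presburger
  next
    case False
    \<comment> \<open>Levels outside the range counted by \<open>layer\<close> contribute no product
      either: no \<open>f t\<close> lies below \<open>y \<le> lo\<close>, and no \<open>g s\<close>
      is at most \<open>w < lo\<close>.\<close>
    then have "{s \<in> A. g s \<le> w \<and> y \<le> f s} = {} \<or> {t \<in> A'. w < g t \<and> f t < y} = {}"
    proof (cases "lo \<le> w")
      case True
      with False have "\<not> f t < y" if "t \<in> A'" for t
        using lo(1)[of t] that sub by auto
      then show ?thesis by blast
    next
      case False
      then have "\<not> g s \<le> w" if "s \<in> A" for s
        using lo(2)[of s] that sub by auto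
      then show ?thesis by blast
    qed
    then have "?a * ?b = 0"
    proof (elim disjE)
      assume e: "{s \<in> A. g s \<le> w \<and> y \<le> f s} = {}"
      show ?thesis unfolding e by simp
    next
      assume e: "{t \<in> A'. w < g t \<and> f t < y} = {}"
      show ?thesis unfolding e by simp
    qed
    then have "ennreal (1 / M) * (a p * b p) = 0" unfolding ab by (simp only: mult_zero_right ennreal_0)
    moreover have "layer lo f g p = 0" using False by (auto simp: layer_def p y_def)
    ultimately show ?thesis by (simp only: add_0 zero_le)
  qed
qed

text \<open>The right side of \<open>layer_cake\<close> is the same for \<open>f\<close> and
  \<open>fs\<close>, so what the layers gain by sorting is exactly what the cost loses.\<close>

lemma rearrangement_gain:
  assumes [measurable]: "f \<in> borel_measurable unit_interval" "fs \<in> borel_measurable unit_interval"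
      "g \<in> borel_measurable unit_interval" "A \<in> sets unit_interval" "A' \<in> sets unit_interval"
    and distr: "distr unit_interval borel fs = distr unit_interval borel f"
    and mono: "mono_on {0..1} fs" "mono_on {0..1} g"
    and bnd: "\<And>x. x \<in> {0..1} \<Longrightarrow> f x \<in> {lo..hi}" "\<And>x. x \<in> {0..1} \<Longrightarrow> fs x \<in> {lo..hi}"
       "\<And>x. x \<in> {0..1} \<Longrightarrow> g x \<in> {lo..hi}"
    and gain: "\<And>s t. s \<in> A \<Longrightarrow> t \<in> A' \<Longrightarrow> f t \<le> f s \<and> g s \<le> g t \<and>
       \<kappa> \<le> c (f t - g t) + c (f s - g s) - c (f t - g s) - c (f s - g t)"
    and \<kappa>: "0 \<le> \<kappa>"
  shows "(\<integral>\<^sup>+x. c (fs x - g x) \<partial>unit_interval) + ennreal (\<kappa> * min (measure unit_interval A) (measure unit_interval A'))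
     \<le> (\<integral>\<^sup>+x. c (f x - g x) \<partial>unit_interval)"
proof -
  define M where "M = max (measure unit_interval A) (measure unit_interval A')"
  define a where "a = (\<lambda>(w, u). emeasure unit_interval {s \<in> A. g s \<le> w \<and> u + w \<le> f s})"
  define b where "b = (\<lambda>(w, u). emeasure unit_interval {t \<in> A'. w < g t \<and> f t < u + w})"
  have M0: "0 \<le> M" by (simp add: M_def le_max_iff_disj)
  have lo: "\<And>x. x \<in> {0..1} \<Longrightarrow> lo \<le> f x" "\<And>x. x \<in> {0..1} \<Longrightarrow> lo \<le> fs x" "\<And>x. x \<in> {0..1} \<Longrightarrow> lo \<le> g x"
    using bnd by auto
  have ab [measurable]: "(\<lambda>p. a p * b p) \<in> borel_measurable levels"
    and ab_ge: "ennreal \<kappa> * (emeasure unit_interval A * emeasure unit_interval A') \<le> (\<integral>\<^sup>+p. a p * b p \<partial>levels)"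
    using exchange_integral[of f g A A' \<kappa>] gain unfolding a_def b_def by auto
  have [measurable]: "layer lo f g \<in> borel_measurable levels"
    by (rule layer_cake(1)) (use lo in auto)
  let ?T = "\<lambda>f. (\<integral>\<^sup>+p. layer lo f g p \<partial>levels)" and ?I = "\<lambda>f. (\<integral>\<^sup>+x. c (f x - g x) \<partial>unit_interval)"
  let ?gain = "ennreal (\<kappa> * min (measure unit_interval A) (measure unit_interval A'))"
  have "?gain = ennreal (1 / M) * (ennreal \<kappa> * (emeasure unit_interval A * emeasure unit_interval A'))"
  proof -
    let ?x = "measure unit_interval A" and ?y = "measure unit_interval A'"
    \<comment> \<open>The product of two numbers is the product of their maximum and minimum;
      dividing by the maximum turns \<open>|A| |A'|\<close> into
      \<open>min |A| |A'|\<close>.\<close>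
    have "min ?x ?y = 1 / M * (?x * ?y)"
      unfolding M_def by (auto simp: min_def max_def field_simps)
         (metis antisym measure_nonneg)+
    then show ?thesis
      using \<kappa> M0 by (simp add: unit_interval.emeasure_eq_measure ennreal_mult[symmetric] mult_ac)
  qed
  also have "\<dots> \<le> ennreal (1 / M) * (\<integral>\<^sup>+p. a p * b p \<partial>levels)"
    by (intro mult_left_mono ab_ge) simp
  also have "\<dots> = (\<integral>\<^sup>+p. ennreal (1 / M) * (a p * b p) \<partial>levels)"
    by (rule nn_integral_cmult[symmetric]) (rule ab)
  finally have "?T f + ?gain \<le> ?T f + (\<integral>\<^sup>+p. ennreal (1 / M) * (a p * b p) \<partial>levels)"
    by (rule add_left_mono)
  also have "\<dots> = (\<integral>\<^sup>+p. layer lo f g p + ennreal (1 / M) * (a p * b p) \<partial>levels)"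
    by (rule nn_integral_add[symmetric]) auto
  also have "\<dots> \<le> ?T fs"
    unfolding a_def b_def M_def
    by (intro nn_integral_mono layer_gain) (use distr mono lo in auto)
  finally have T: "?T f + ?gain \<le> ?T fs" .
  have eqI: "(\<integral>\<^sup>+x. c (fs x - lo) \<partial>unit_interval) = (\<integral>\<^sup>+x. c (f x - lo) \<partial>unit_interval)"
  proof -
    have "(\<integral>\<^sup>+v. c (v - lo) \<partial>distr unit_interval borel fs) = (\<integral>\<^sup>+v. c (v - lo) \<partial>distr unit_interval borel f)"
      by (simp add: distr)
    then show ?thesis by (simp add: nn_integral_distr)
  qed
  have "?I fs + ?T fs + c 0 = ?I f + ?T f + c 0"
    using layer_cake(2)[of fs g lo] layer_cake(2)[of f g lo] lo by (simp add: eqI)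
  \<comment> \<open>Finiteness licenses the cancellation of \<open>?T f + c 0\<close> at the end. It
    holds because all differences lie in a compact interval, where the continuous cost is
    bounded.\<close>
  moreover have fin: "?T f + c 0 < \<top>"
  proof -
    have "bounded (c ` {lo - hi..hi - lo})"
      by (intro compact_imp_bounded compact_continuous_image continuous_on_subset[OF cost_cont]) auto
    then obtain B where "\<And>x. x \<in> {lo - hi..hi - lo} \<Longrightarrow> norm (c x) \<le> B"
      unfolding bounded_iff by blast
    then have B: "\<And>x. x \<in> {lo - hi..hi - lo} \<Longrightarrow> c x \<le> B"
      by (simp add: cost_nonneg)
    have bound: "(\<integral>\<^sup>+x. c (h x) \<partial>unit_interval) \<le> ennreal B" if "\<And>x. x \<in> {0..1} \<Longrightarrow> h x \<in> {lo - hi..hi - lo}" for h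
    proof -
      have "(\<integral>\<^sup>+x. c (h x) \<partial>unit_interval) \<le> (\<integral>\<^sup>+x. ennreal B \<partial>unit_interval)"
        using that B by (intro nn_integral_mono ennreal_leI) auto
      then show ?thesis by (simp add: unit_interval.emeasure_space_1[simplified])
    qed
    have "?T f + c 0 \<le> ?I f + ?T f + c 0" by (simp add: add_increasing)
    also have "\<dots> = (\<integral>\<^sup>+x. c (lo - g x) \<partial>unit_interval) + (\<integral>\<^sup>+x. c (f x - lo) \<partial>unit_interval)"
      by (rule layer_cake(2)) (use lo in auto)
    also have "\<dots> \<le> ennreal B + ennreal B"
      by (intro add_mono bound) (use bnd in \<open>force+\<close>)
    also have "\<dots> < \<top>" by simp
    finally show ?thesis .
  qed
  moreover have "?I fs + ?gain + (?T f + c 0) \<le> ?I fs + ?T fs + c 0"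
    using add_left_mono[OF T, of "?I fs + c 0"] by (simp add: ac_simps)
  ultimately have "(?T f + c 0) + (?I fs + ?gain) \<le> (?T f + c 0) + ?I f"
    by (simp add: ac_simps)
  then show ?thesis
    using fin by (auto simp: ennreal_add_left_cancel_le)
qed

end

section \<open>Quantile functions\<close>

definition quantile :: "(real \<Rightarrow> ereal) \<Rightarrow> real \<Rightarrow> ereal" where
  "quantile u r = (INF y \<in> {y::real. (\<integral>\<^sup>+ t. indicator {t. u t \<le> ereal y} t \<partial>unit_interval) \<ge> ennreal r}. ereal y)"

lemma rearr_eq_quantile: "rearr j f x = quantile (\<lambda>t. f (x(j := t))) (x j)"
  by (simp add: rearr_def quantile_def)

text \<open>The quantile sees \<open>u\<close> only through integrals of indicators of its sublevel
  sets. This is what permits replacing a slice by that of a Borel version.\<close>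

lemma quantile_AE_cong:
  assumes "AE t in unit_interval. u t = u' t"
  shows "quantile u = quantile u'"
proof -
  have "(\<integral>\<^sup>+ t. indicator {t. u t \<le> ereal y} t \<partial>unit_interval) = (\<integral>\<^sup>+ t. indicator {t. u' t \<le> ereal y} t \<partial>unit_interval)" for y
    using assms by (intro nn_integral_cong_AE) (auto elim!: eventually_mono simp: indicator_def)
  then show ?thesis by (simp add: quantile_def fun_eq_iff)
qed

text \<open>A smaller function has larger sublevel sets, hence more admissible \<open>y\<close> in
  the infimum. Only monotonicity of \<open>nn_integral\<close> is used, so the argument covers
  non-measurable slices and infinite values.\<close>

lemma quantile_mono:
  assumes "\<And>t. t \<in> {0..1} \<Longrightarrow> u t \<le> u' t" "r \<le> r'"
  shows "quantile u r \<le> quantile u' r'"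
  unfolding quantile_def
proof (rule INF_superset_mono[OF _ order_refl], intro subsetI CollectI)
  fix y assume y: "y \<in> {y. ennreal r' \<le> (\<integral>\<^sup>+ t. indicator {t. u' t \<le> ereal y} t \<partial>unit_interval)}"
  have "ennreal r \<le> ennreal r'" using assms(2) by (rule ennreal_leI)
  also have "\<dots> \<le> (\<integral>\<^sup>+ t. indicator {t. u' t \<le> ereal y} t \<partial>unit_interval)" using y by simp
  also have "\<dots> \<le> (\<integral>\<^sup>+ t. indicator {t. u t \<le> ereal y} t \<partial>unit_interval)"
    using assms(1) by (intro nn_integral_mono) (auto simp: indicator_def intro: order_trans)
  finally show "ennreal r \<le> (\<integral>\<^sup>+ t. indicator {t. u t \<le> ereal y} t \<partial>unit_interval)" .
qed

lemma sublevel_sets: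
  assumes [measurable]: "h \<in> borel_measurable unit_interval"
  shows "{t \<in> {0..1}. h t \<le> (y :: real)} \<in> sets unit_interval"
proof -
  have "{t \<in> space unit_interval. h t \<le> y} \<in> sets unit_interval" by measurable
  then show ?thesis by simp
qed

lemma nn_integral_sublevel:
  assumes [measurable]: "h \<in> borel_measurable unit_interval"
  shows "(\<integral>\<^sup>+ t. indicator {t. ereal (h t) \<le> ereal y} t \<partial>unit_interval) = emeasure unit_interval {t \<in> {0..1}. h t \<le> y}"
proof -
  have "(\<integral>\<^sup>+ t. indicator {t. ereal (h t) \<le> ereal y} t \<partial>unit_interval) =
      (\<integral>\<^sup>+ t. indicator {t \<in> {0..1}. h t \<le> y} t \<partial>unit_interval)"
    by (rule nn_integral_cong) (auto simp: indicator_def)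
  then show ?thesis using sublevel_sets[OF assms] by simp
qed

text \<open>Right continuity of the distribution function makes the infimum attained.\<close>

lemma quantile_le_iff:
  assumes h: "h \<in> borel_measurable unit_interval"
  shows "quantile (\<lambda>t. ereal (h t)) r \<le> ereal y \<longleftrightarrow> ennreal r \<le> emeasure unit_interval {t \<in> {0..1}. h t \<le> y}"
proof
  assume "ennreal r \<le> emeasure unit_interval {t \<in> {0..1}. h t \<le> y}"
  then show "quantile (\<lambda>t. ereal (h t)) r \<le> ereal y"
    unfolding quantile_def nn_integral_sublevel[OF h] by (intro INF_lower) simp
next
  assume le: "quantile (\<lambda>t. ereal (h t)) r \<le> ereal y"
  have "ennreal r \<le> emeasure unit_interval {t \<in> {0..1}. h t \<le> y + 1 / real (Suc n)}" for n
  proof -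
    have "ereal y < ereal (y + 1 / real (Suc n))" by simp
    with le have "quantile (\<lambda>t. ereal (h t)) r < ereal (y + 1 / real (Suc n))" by (rule le_less_trans)
    then obtain y' where y': "y' < y + 1 / real (Suc n)" "ennreal r \<le> emeasure unit_interval {t \<in> {0..1}. h t \<le> y'}"
      unfolding quantile_def nn_integral_sublevel[OF h] INF_less_iff by auto
    note y'(2)
    also have "emeasure unit_interval {t \<in> {0..1}. h t \<le> y'} \<le> emeasure unit_interval {t \<in> {0..1}. h t \<le> y + 1 / real (Suc n)}"
      using y'(1) by (intro emeasure_mono sublevel_sets h) auto
    finally show ?thesis .
  qed
  moreover have "(\<lambda>n. emeasure unit_interval {t \<in> {0..1}. h t \<le> y + 1 / real (Suc n)}) \<longlonglongrightarrow>
     emeasure unit_interval (\<Inter>n. {t \<in> {0..1}. h t \<le> y + 1 / real (Suc n)})"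
  proof (rule Lim_emeasure_decseq)
    show "range (\<lambda>n. {t \<in> {0..1}. h t \<le> y + 1 / real (Suc n)}) \<subseteq> sets unit_interval"
      using sublevel_sets[OF h] by auto
    have "y + 1 / real (Suc n) \<le> y + 1 / real (Suc m)" if "m \<le> n" for m n
      using that by (simp add: frac_le)
    then show "decseq (\<lambda>n. {t \<in> {0..1}. h t \<le> y + 1 / real (Suc n)})"
      unfolding decseq_def by (auto intro: order_trans)
  qed simp
  moreover have "(\<Inter>n. {t \<in> {0..1}. h t \<le> y + 1 / real (Suc n)}) = {t \<in> {0..1}. h t \<le> y}"
  proof -
    have "h t \<le> y" if "\<And>n. h t \<le> y + 1 / real (Suc n)" for t
    proof (rule LIMSEQ_le_const)
      show "(\<lambda>n. y + 1 / real (Suc n)) \<longlonglongrightarrow> y"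
        using tendsto_add[OF tendsto_const LIMSEQ_inverse_real_of_nat, of y] by (simp add: inverse_eq_divide)
    qed (use that in auto)
    moreover have "h t \<le> y + 1 / real (Suc n)" if "h t \<le> y" for t n
      using that by (smt (verit) divide_nonneg_nonneg of_nat_0_le_iff)
    ultimately show ?thesis by blast
  qed
  ultimately show "ennreal r \<le> emeasure unit_interval {t \<in> {0..1}. h t \<le> y}"
    using LIMSEQ_le_const by (metis (no_types, lifting))
qed

text \<open>A point \<open>q\<close> outside \<open>C\<close> has a gap of some radius
  \<open>e\<close> around it, so \<open>q\<close> and \<open>q - e / 2\<close> have the same
  sublevel set and \<open>q\<close> could not be the infimum. The bounds \<open>r \<le> 1\<close>
  and \<open>0 < r\<close> exclude the two infinite values.\<close>

lemma quantile_in_closed: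
  assumes h: "h \<in> borel_measurable unit_interval" and C: "closed C" "bounded C"
    and hC: "\<And>t. t \<in> {0..1} \<Longrightarrow> h t \<in> C" and r: "0 < r" "r \<le> 1"
  obtains q where "q \<in> C" "quantile (\<lambda>t. ereal (h t)) r = ereal q"
proof -
  obtain B where B: "\<And>x. x \<in> C \<Longrightarrow> \<bar>x\<bar> \<le> B" using C(2) unfolding bounded_iff by auto
  have up: "quantile (\<lambda>t. ereal (h t)) r \<le> ereal B"
  proof -
    have "{t \<in> {0..1}. h t \<le> B} = {0..1}" using hC B by fastforce
    then show ?thesis using r
      by (subst quantile_le_iff[OF h]) (simp add: emeasure_restrict_space)
  qed
  have low: "\<not> quantile (\<lambda>t. ereal (h t)) r \<le> ereal (- B - 1)"
  proof -
    have "h t > - B - 1" if "t \<in> {0..1}" for t using B[OF hC[OF that]] by linarith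
    then have e: "{t \<in> {0..1}. h t \<le> - B - 1} = {}" by (auto simp: not_le[symmetric])
    show ?thesis unfolding quantile_le_iff[OF h] e using r by simp
  qed
  obtain q where q: "quantile (\<lambda>t. ereal (h t)) r = ereal q"
    using up low by (cases "quantile (\<lambda>t. ereal (h t)) r") auto
  have "q \<in> C"
  proof (rule ccontr)
    assume "q \<notin> C"
    then obtain e where e: "e > 0" "\<And>x. x \<in> C \<Longrightarrow> e \<le> \<bar>x - q\<bar>"
      using separate_point_closed[OF C(1)] by (metis dist_real_def abs_minus_commute)
    have "{t \<in> {0..1}. h t \<le> q} \<subseteq> {t \<in> {0..1}. h t \<le> q - e / 2}"
    proof safe
      fix t assume t: "t \<in> {0..1}" "h t \<le> q"
      show "h t \<le> q - e / 2" using e(1) e(2)[OF hC[OF t(1)]] t(2) by linarith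
    qed
    then have "emeasure unit_interval {t \<in> {0..1}. h t \<le> q} \<le> emeasure unit_interval {t \<in> {0..1}. h t \<le> q - e / 2}"
      by (intro emeasure_mono sublevel_sets h)
    moreover have "ennreal r \<le> emeasure unit_interval {t \<in> {0..1}. h t \<le> q}"
      using quantile_le_iff[OF h, of r q] q by simp
    ultimately have "quantile (\<lambda>t. ereal (h t)) r \<le> ereal (q - e / 2)"
      unfolding quantile_le_iff[OF h] by (rule order_trans[rotated])
    then show False using q e(1) by simp
  qed
  then show ?thesis using q that by blast
qed

text \<open>
  The value \<open>- \<infinity>\<close> of the quantile function at \<open>0\<close> is replaced by \<open>m\<close>; taking for \<open>m\<close> the
  least admissible value keeps the function increasing.
\<close>

definition real_quantile :: "real \<Rightarrow> (real \<Rightarrow> real) \<Rightarrow> real \<Rightarrow> real" where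
  "real_quantile m h r = (if r = 0 then m else real_of_ereal (quantile (\<lambda>t. ereal (h t)) r))"

lemma real_quantile_in:
  assumes "h \<in> borel_measurable unit_interval" "closed C" "bounded C" "m \<in> C"
    and "\<And>t. t \<in> {0..1} \<Longrightarrow> h t \<in> C" "r \<in> {0..1}"
  shows "real_quantile m h r \<in> C"
proof (cases "r = 0")
  case False
  then have "0 < r" "r \<le> 1" using assms(6) by auto
  then obtain q where "q \<in> C" "quantile (\<lambda>t. ereal (h t)) r = ereal q"
    using quantile_in_closed[OF assms(1-3,5)] by blast
  then show ?thesis using False by (simp add: real_quantile_def)
qed (use assms in \<open>simp add: real_quantile_def\<close>)

lemma ereal_real_quantile:
  assumes "h \<in> borel_measurable unit_interval" "closed C" "bounded C"
    and "\<And>t. t \<in> {0..1} \<Longrightarrow> h t \<in> C" "r \<in> {0<..1}"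
  shows "ereal (real_quantile m h r) = quantile (\<lambda>t. ereal (h t)) r"
proof -
  have "0 < r" "r \<le> 1" using assms(5) by auto
  then obtain q where "quantile (\<lambda>t. ereal (h t)) r = ereal q"
    using quantile_in_closed[OF assms(1-4)] by blast
  then show ?thesis using \<open>0 < r\<close> by (simp add: real_quantile_def)
qed

lemma real_quantile_le_iff:
  assumes "h \<in> borel_measurable unit_interval" "closed C" "bounded C"
    and "\<And>t. t \<in> {0..1} \<Longrightarrow> h t \<in> C" "r \<in> {0<..1}"
  shows "real_quantile m h r \<le> y \<longleftrightarrow> ennreal r \<le> emeasure unit_interval {t \<in> {0..1}. h t \<le> y}"
proof -
  have "real_quantile m h r \<le> y \<longleftrightarrow> ereal (real_quantile m h r) \<le> ereal y" by simp
  also have "\<dots> \<longleftrightarrow> quantile (\<lambda>t. ereal (h t)) r \<le> ereal y"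
    by (simp only: ereal_real_quantile[OF assms])
  also have "\<dots> \<longleftrightarrow> ennreal r \<le> emeasure unit_interval {t \<in> {0..1}. h t \<le> y}"
    by (rule quantile_le_iff[OF assms(1)])
  finally show ?thesis .
qed

lemma mono_on_real_quantile:
  assumes "h \<in> borel_measurable unit_interval" "closed C" "bounded C"
    and "\<And>t. t \<in> {0..1} \<Longrightarrow> h t \<in> C" "m \<in> C" "\<And>x. x \<in> C \<Longrightarrow> m \<le> x"
  shows "mono_on {0..1} (real_quantile m h)"
proof (rule mono_onI)
  fix r s :: real assume rs: "r \<in> {0..1}" "s \<in> {0..1}" "r \<le> s"
  show "real_quantile m h r \<le> real_quantile m h s"
  proof (cases "r = 0")
    case True
    then show ?thesis
      using assms(6)[OF real_quantile_in[OF assms(1-3,5,4) rs(2)]] by (simp add: real_quantile_def)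
  next
    case False
    then have "ereal (real_quantile m h r) \<le> ereal (real_quantile m h s)"
      using rs by (subst (1 2) ereal_real_quantile[OF assms(1-4)]) (auto intro!: quantile_mono)
    then show ?thesis by simp
  qed
qed

lemma mono_on_unit_interval_measurable:
  assumes "mono_on {0..1} (h :: real \<Rightarrow> real)"
  shows "h \<in> borel_measurable unit_interval"
proof -
  have "(\<lambda>x. indicator {0..1} x *\<^sub>R h x) \<in> borel_measurable borel"
    using borel_measurable_mono_on_fnc[OF assms] by (subst (asm) borel_measurable_restrict_space_iff) auto
  then have "(\<lambda>x. indicator {0..1} x *\<^sub>R h x) \<in> borel_measurable lebesgue"
    by (intro measurable_completion) simp
  then show ?thesis
    by (rule borel_measurable_restrict_space_iff[THEN iffD2, rotated]) simp
qed

text \<open>The distribution functions agree: with \<open>G\<close> the measure of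
  \<open>{h \<le> y}\<close>, the quantile is at most \<open>y\<close> exactly on
  \<open>{0..G}\<close>, an interval of length \<open>G\<close>.\<close>

lemma distr_real_quantile:
  assumes h: "h \<in> borel_measurable unit_interval" "closed C" "bounded C"
    and hC: "\<And>t. t \<in> {0..1} \<Longrightarrow> h t \<in> C" "m \<in> C" "\<And>x. x \<in> C \<Longrightarrow> m \<le> x"
  shows "distr unit_interval borel (real_quantile m h) = distr unit_interval borel h"
proof (rule cdf_unique)
  have q: "real_quantile m h \<in> borel_measurable unit_interval"
    by (intro mono_on_unit_interval_measurable mono_on_real_quantile[OF assms])
  show "real_distribution (distr unit_interval borel (real_quantile m h))"
    using q by (intro unit_interval.real_distribution_distr)
  show "real_distribution (distr unit_interval borel h)"
    using h(1) by (intro unit_interval.real_distribution_distr)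
  show "cdf (distr unit_interval borel (real_quantile m h)) = cdf (distr unit_interval borel h)"
  proof
    fix y
    have "measure unit_interval {r \<in> {0..1}. real_quantile m h r \<le> y} = measure unit_interval {t \<in> {0..1}. h t \<le> y}"
    proof (cases "m \<le> y")
      case True
      define G where "G = measure unit_interval {t \<in> {0..1}. h t \<le> y}"
      have G: "0 \<le> G" "G \<le> 1" by (auto simp: G_def)
      \<comment> \<open>At \<open>r = 0\<close> the value is \<open>m\<close>, and the case
        assumption \<open>m \<le> y\<close> is what places it in the sublevel set.\<close>
      have "real_quantile m h r \<le> y \<longleftrightarrow> r \<le> G" if "r \<in> {0..1}" for r
      proof (cases "r = 0")
        case False
        then show ?thesis
          using real_quantile_le_iff[OF h hC(1), of r m y] that by (simp add: unit_interval.emeasure_eq_measure G_def)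
      qed (use True G in \<open>simp add: real_quantile_def\<close>)
      then have "{r \<in> {0..1}. real_quantile m h r \<le> y} = {0..G}" using G by auto
      then show ?thesis using G unfolding G_def[symmetric] by (simp add: measure_restrict_space)
    next
      case False
      then have "\<not> real_quantile m h r \<le> y" "\<not> h r \<le> y" if "r \<in> {0..1}" for r
        using hC(3)[OF real_quantile_in[OF h hC(2,1) that]] hC(3)[OF hC(1)[OF that]] by auto
      then have "{r \<in> {0..1}. real_quantile m h r \<le> y} = {}" "{t \<in> {0..1}. h t \<le> y} = {}" by auto
      then show ?thesis by (simp only:)
    qed
    then show "cdf (distr unit_interval borel (real_quantile m h)) y = cdf (distr unit_interval borel h) y"
      using q h(1) by (simp add: cdf_def measure_distr vimage_def Int_def conj_commute)
  qed
qed

section \<open>Rearrangement in one coordinate\<close>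

text \<open>\<open>F\<close> may be infinite or irregular on a null set; \<open>g\<close> is regular
  everywhere. All slices of \<open>g\<close> are measurable and the range condition on
  \<open>g\<close> holds at every point, so slice arguments need no exceptional set for
  \<open>g\<close>.\<close>

definition borel_version :: "nat set \<Rightarrow> real set \<Rightarrow> ((nat \<Rightarrow> real) \<Rightarrow> ereal) \<Rightarrow> ((nat \<Rightarrow> real) \<Rightarrow> real) \<Rightarrow> bool" where
  "borel_version I C F g \<longleftrightarrow> g \<in> borel_measurable (\<Pi>\<^sub>M i\<in>I. lborel) \<and> range g \<subseteq> C \<and>
     (AE x in cube_measure I. F x = ereal (g x))"

text \<open>The value \<open>m\<close>, taken outside the cube and, through
  \<open>real_quantile\<close>, on the face \<open>x j = 0\<close>, keeps the whole range in
  \<open>C\<close>.\<close>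

definition rearr_version :: "nat set \<Rightarrow> nat \<Rightarrow> real \<Rightarrow> ((nat \<Rightarrow> real) \<Rightarrow> real) \<Rightarrow> (nat \<Rightarrow> real) \<Rightarrow> real" where
  "rearr_version I j m g x = (if x \<in> cube I then real_quantile m (\<lambda>t. g (x(j := t))) (x j) else m)"

lemma borel_slice_measurable:
  assumes g: "g \<in> borel_measurable (\<Pi>\<^sub>M i\<in>insert j J. lborel)" and z: "z \<in> space (\<Pi>\<^sub>M i\<in>J. (lborel :: real measure))"
  shows "(\<lambda>t. g (z(j := t))) \<in> borel_measurable unit_interval"
proof -
  have "(\<lambda>t. z(j := t)) \<in> measurable lborel (\<Pi>\<^sub>M i\<in>insert j J. (lborel :: real measure))"
    by (rule measurable_fun_upd[where J = J and f = "\<lambda>_. z" and h = "\<lambda>t. t"]) (use z in auto)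
  then have "(\<lambda>t. g (z(j := t))) \<in> borel_measurable lborel"
    using g by (rule measurable_compose)
  then show ?thesis
    by (intro measurable_restrict_space1 measurable_completion)
qed

lemma cube_space_PiM: "x \<in> cube I \<Longrightarrow> x \<in> space (\<Pi>\<^sub>M i\<in>I. (lborel :: real measure))"
  by (auto simp: cube_def space_PiM PiE_iff)

text \<open>Away from the face and inside the cube, the value at \<open>x\<close> is at most
  \<open>y\<close> iff \<open>x j\<close> is at most the length \<open>G x\<close> of the sublevel
  set of the slice through \<open>x\<close>. Measurability of \<open>G\<close> is part of Tonelli's
  theorem.\<close>

lemma rearr_version_measurable:
  assumes "finite I" "j \<in> I" and g [measurable]: "g \<in> borel_measurable (\<Pi>\<^sub>M i\<in>I. lborel)"
    and C: "range g \<subseteq> C" "closed C" "bounded C"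
  shows "rearr_version I j m g \<in> borel_measurable (\<Pi>\<^sub>M i\<in>I. lborel)"
proof (rule borel_measurable_iff_le[THEN iffD2], intro allI)
  fix y
  let ?P = "\<Pi>\<^sub>M i\<in>I. (lborel :: real measure)"
  have [measurable]: "cube I \<in> sets ?P" by (rule cube_sets) fact
  have [measurable]: "(\<lambda>x. x j) \<in> borel_measurable ?P"
    using measurable_component_singleton[OF \<open>j \<in> I\<close>, of "\<lambda>_. lborel"] by simp
  have upd: "(\<lambda>p. (fst p)(j := snd p)) \<in> measurable (?P \<Otimes>\<^sub>M lborel) ?P"
    by (rule measurable_fun_upd[where J = I]) (use \<open>j \<in> I\<close> in auto)
  have [measurable]: "(\<lambda>p. g ((fst p)(j := snd p))) \<in> borel_measurable (?P \<Otimes>\<^sub>M lborel)"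
    using upd g by (rule measurable_compose)
  define G where "G x = (\<integral>\<^sup>+t. indicator {..y} (g (x(j := t))) * indicator {0..1} t \<partial>lborel)" for x
  have G: "emeasure unit_interval {t \<in> {0..1}. g (x(j := t)) \<le> y} = G x" if "x \<in> cube I" for x
  proof -
    have "(\<lambda>t. g (x(j := t))) \<in> borel_measurable unit_interval"
      using g cube_space_PiM[OF that] \<open>j \<in> I\<close> by (intro borel_slice_measurable[of g j I]) (auto simp: insert_absorb)
    then have "emeasure unit_interval {t \<in> {0..1}. g (x(j := t)) \<le> y} =
      (\<integral>\<^sup>+t. indicator {t \<in> {0..1}. g (x(j := t)) \<le> y} t \<partial>unit_interval)"
      by (subst nn_integral_indicator) (auto dest: sublevel_sets)
    also have "\<dots> = (\<integral>\<^sup>+t. indicator {..y} (g (x(j := t))) * indicator {0..1} t \<partial>lborel)"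
      unfolding nn_integral_unit_interval by (rule nn_integral_cong) (auto simp: indicator_def)
    finally show ?thesis by (simp add: G_def)
  qed
  have "(\<lambda>x. \<integral>\<^sup>+t. indicator {..y} (g (x(j := t))) * indicator {0..1} t \<partial>lborel) \<in> borel_measurable ?P"
    by (rule lborel.borel_measurable_nn_integral) (simp add: case_prod_beta)
  then have G_meas: "G \<in> borel_measurable ?P"
    unfolding G_def .
  let ?N = "{x \<in> space ?P. x j \<noteq> 0} \<inter> cube I"
  have N: "?N \<in> sets ?P"
    by (intro sets.Int borel_measurable_neq) auto
  have "{x \<in> space ?P. ennreal (x j) \<le> G x} \<in> sets ?P"
    by (intro borel_measurable_le G_meas measurable_compose[OF _ measurable_ennreal]) fact
  with N have "{x \<in> space ?P. ennreal (x j) \<le> G x} \<inter> ?N \<union> ((if m \<le> y then space ?P else {}) - ?N) \<in> sets ?P"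
    by auto
  also have "{x \<in> space ?P. ennreal (x j) \<le> G x} \<inter> ?N \<union> ((if m \<le> y then space ?P else {}) - ?N) =
      {x \<in> space ?P. if x \<in> cube I \<and> x j \<noteq> 0 then ennreal (x j) \<le> G x else m \<le> y}"
    by (auto split: if_splits)
  also have "{x \<in> space ?P. if x \<in> cube I \<and> x j \<noteq> 0 then ennreal (x j) \<le> G x else m \<le> y} =
     {x \<in> space ?P. rearr_version I j m g x \<le> y}"
  proof (rule Collect_cong, rule conj_cong[OF refl])
    fix x assume x: "x \<in> space ?P"
    show "(if x \<in> cube I \<and> x j \<noteq> 0 then ennreal (x j) \<le> G x else m \<le> y) =
      (rearr_version I j m g x \<le> y)"
    proof (cases "x \<in> cube I \<and> x j \<noteq> 0")
      case True
      then have "x j \<in> {0<..1}" using \<open>j \<in> I\<close> by (force simp: cube_def)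
      moreover have "(\<lambda>t. g (x(j := t))) \<in> borel_measurable unit_interval"
        using g x \<open>j \<in> I\<close> by (intro borel_slice_measurable[of g j I]) (auto simp: insert_absorb)
      ultimately have "(real_quantile m (\<lambda>t. g (x(j := t))) (x j) \<le> y) =
          (ennreal (x j) \<le> emeasure unit_interval {t \<in> {0..1}. g (x(j := t)) \<le> y})"
        using C by (intro real_quantile_le_iff[of _ C]) auto
      then show ?thesis using True G by (simp add: rearr_version_def)
    next
      case False
      then show ?thesis by (auto simp: rearr_version_def real_quantile_def)
    qed
  qed
  finally show "{x \<in> space ?P. rearr_version I j m g x \<le> y} \<in> sets ?P" .
qed

lemma rearr_version_range:
  assumes "j \<in> I" "g \<in> borel_measurable (\<Pi>\<^sub>M i\<in>I. lborel)"
    and C: "range g \<subseteq> C" "closed C" "bounded C" "m \<in> C"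
  shows "rearr_version I j m g x \<in> C"
proof (cases "x \<in> cube I")
  case True
  then have "(\<lambda>t. g (x(j := t))) \<in> borel_measurable unit_interval"
    using assms(1,2) cube_space_PiM by (intro borel_slice_measurable[of g j I]) (auto simp: insert_absorb)
  moreover have "x j \<in> {0..1}" using True \<open>j \<in> I\<close> by (force simp: cube_def)
  ultimately show ?thesis
    using True C by (auto simp: rearr_version_def intro!: real_quantile_in)
qed (use C in \<open>simp add: rearr_version_def\<close>)

text \<open>On almost every line in direction \<open>j\<close> the functions \<open>F\<close> and
  \<open>g\<close> agree almost everywhere and so have the same quantile function; off the face
  \<open>x j = 0\<close> this quantile is finite.\<close>

lemma borel_version_rearr:
  assumes I: "finite I" "j \<in> I" and F: "borel_version I C F g"
    and C: "closed C" "bounded C" "m \<in> C"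
  shows "borel_version I C (rearr j F) (rearr_version I j m g)"
  unfolding borel_version_def
proof (intro conjI)
  have g: "g \<in> borel_measurable (\<Pi>\<^sub>M i\<in>I. lborel)" "range g \<subseteq> C" "AE x in cube_measure I. F x = ereal (g x)"
    using F by (auto simp: borel_version_def)
  show "rearr_version I j m g \<in> borel_measurable (\<Pi>\<^sub>M i\<in>I. lborel)"
    by (rule rearr_version_measurable[OF I g(1,2) C(1,2)])
  show "range (rearr_version I j m g) \<subseteq> C"
    using rearr_version_range[OF I(2) g(1,2) C] by auto
  define J where "J = I - {j}"
  have J: "I = insert j J" "finite J" "j \<notin> J" using I by (auto simp: J_def)
  have "AE z in cube_measure J. AE t in unit_interval. F (z(j := t)) = ereal (g (z(j := t)))"
    using g(3) unfolding J(1) by (rule AE_cube_slice[OF J(2,3)])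
  from AE_cube_lift[OF J(2,3) this]
  have "AE x in cube_measure I. AE t in unit_interval. F ((restrict x J)(j := t)) = ereal (g ((restrict x J)(j := t)))"
    unfolding J(1) .
  then show "AE x in cube_measure I. rearr j F x = ereal (rearr_version I j m g x)"
    using AE_cube_nonzero[OF I] AE_space
  proof eventually_elim
    case (elim x)
    then have x: "x \<in> cube I" by simp
    then have "(restrict x J)(j := t) = x(j := t)" for t
      using J by (auto simp: cube_def fun_eq_iff PiE_iff extensional_def restrict_def)
    then have "rearr j F x = quantile (\<lambda>t. ereal (g (x(j := t)))) (x j)"
      unfolding rearr_eq_quantile using elim(1) by (intro fun_cong[OF quantile_AE_cong]) simp
    also have "\<dots> = ereal (real_quantile m (\<lambda>t. g (x(j := t))) (x j))"
    proof (rule ereal_real_quantile[symmetric])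
      show "(\<lambda>t. g (x(j := t))) \<in> borel_measurable unit_interval"
        using g(1) I(2) cube_space_PiM[OF x] by (intro borel_slice_measurable[of g j I]) (auto simp: insert_absorb)
      show "x j \<in> {0<..1}" using x elim(2) I(2) by (force simp: cube_def)
    qed (use C g(2) in auto)
    finally show ?case using x by (simp add: rearr_version_def)
  qed
qed

section \<open>Integration of the slice gains over the remaining coordinates\<close>

context convex_cost
begin

text \<open>The slice inequality is integrated over \<open>z\<close>, with a gain only for
  \<open>z\<close> in \<open>Z\<close>. The assumption \<open>gain\<close> speaks of
  \<open>F\<close> and not of \<open>g\<close>, as the strict gain condition is a pointwise one on
  the given function.\<close>

lemma rearr_cost_gain:
  assumes I: "finite I" "j \<in> I" and F: "borel_version I C F g" and F0: "borel_version I C (\<lambda>x. ereal (f0 x)) g0"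
    and C: "closed C" "bounded C" "m \<in> C" "\<And>x. x \<in> C \<Longrightarrow> m \<le> x"
    and f0: "mono_on (cube I) f0" "f0 \<in> cube I \<rightarrow> C"
    and sets: "A \<in> sets unit_interval" "A' \<in> sets unit_interval" "Z \<in> sets (cube_measure (I - {j}))"
    and gain: "\<And>s t z v v'. s \<in> A \<Longrightarrow> t \<in> A' \<Longrightarrow> z \<in> Z \<Longrightarrow> v \<in> C \<Longrightarrow> v' \<in> C \<Longrightarrow>
       F (z(j := t)) = ereal v \<Longrightarrow> F (z(j := s)) = ereal v' \<Longrightarrow>
       v \<le> v' \<and> f0 (z(j := s)) \<le> f0 (z(j := t)) \<and>
       \<kappa> \<le> c (v - f0 (z(j := t))) + c (v' - f0 (z(j := s))) - c (v - f0 (z(j := s))) - c (v' - f0 (z(j := t)))"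
    and \<kappa>: "0 \<le> \<kappa>"
  shows "(\<integral>\<^sup>+x. c (rearr_version I j m g x - g0 x) \<partial>cube_measure I) +
      ennreal (\<kappa> * min (measure unit_interval A) (measure unit_interval A')) * emeasure (cube_measure (I - {j})) Z
    \<le> (\<integral>\<^sup>+x. c (g x - g0 x) \<partial>cube_measure I)"
proof -
  define J where "J = I - {j}"
  have J: "I = insert j J" "finite J" "j \<notin> J" using I by (auto simp: J_def)
  let ?P = "\<Pi>\<^sub>M i\<in>I. (lborel :: real measure)" and ?h = "rearr_version I j m g"
  have g: "g \<in> borel_measurable ?P" "range g \<subseteq> C" "AE x in cube_measure I. F x = ereal (g x)"
    using F by (auto simp: borel_version_def)
  have g0: "g0 \<in> borel_measurable ?P" "range g0 \<subseteq> C" "AE x in cube_measure I. ereal (f0 x) = ereal (g0 x)"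
    using F0 by (auto simp: borel_version_def)
  have h: "?h \<in> borel_measurable ?P" by (rule rearr_version_measurable[OF I g(1,2) C(1,2)])
  obtain B where B: "\<And>x. x \<in> C \<Longrightarrow> \<bar>x\<bar> \<le> B" using C(2) unfolding bounded_iff by auto
  let ?gain = "ennreal (\<kappa> * min (measure unit_interval A) (measure unit_interval A'))"
  let ?S = "\<lambda>g z. (\<integral>\<^sup>+t. c (g (z(j := t)) - g0 (z(j := t))) \<partial>unit_interval)"
  have S: "(\<integral>\<^sup>+x. c (g x - g0 x) \<partial>cube_measure I) = (\<integral>\<^sup>+z. ?S g z \<partial>cube_measure J)"
    if "g \<in> borel_measurable ?P" for g
  proof -
    have "(\<lambda>x. ennreal (c (g x - g0 x))) \<in> borel_measurable ?P"
      by (intro measurable_compose[OF _ measurable_ennreal] measurable_compose[OF _ cost_measurable]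
          borel_measurable_diff that g0(1))
    then show ?thesis unfolding J(1) by (intro nn_integral_cube_insert J(2,3))
  qed
  have S_meas: "(\<lambda>z. ?S ?h z) \<in> borel_measurable (cube_measure J)"
  proof (rule borel_measurable_cube[OF J(2)])
    have upd: "(\<lambda>p. (fst p)(j := snd p)) \<in> measurable ((\<Pi>\<^sub>M i\<in>J. lborel) \<Otimes>\<^sub>M lborel) ?P"
      by (rule measurable_fun_upd[where J = J]) (use J in auto)
    have [measurable]: "(\<lambda>p. ?h ((fst p)(j := snd p))) \<in> borel_measurable ((\<Pi>\<^sub>M i\<in>J. lborel) \<Otimes>\<^sub>M lborel)"
      "(\<lambda>p. g0 ((fst p)(j := snd p))) \<in> borel_measurable ((\<Pi>\<^sub>M i\<in>J. lborel) \<Otimes>\<^sub>M lborel)"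
      using upd h g0(1) by (auto intro: measurable_compose)
    show "(\<lambda>z. ?S ?h z) \<in> borel_measurable (\<Pi>\<^sub>M i\<in>J. lborel)"
      unfolding nn_integral_unit_interval
      by (rule lborel.borel_measurable_nn_integral) (simp add: case_prod_beta)
  qed
  have "AE z in cube_measure J. AE t in unit_interval. F (z(j := t)) = ereal (g (z(j := t)))"
    using g(3) unfolding J(1) by (rule AE_cube_slice[OF J(2,3)])
  moreover have "AE z in cube_measure J. AE t in unit_interval. ereal (f0 (z(j := t))) = ereal (g0 (z(j := t)))"
    using g0(3) unfolding J(1) by (rule AE_cube_slice[OF J(2,3)])
  ultimately have main: "AE z in cube_measure J. ?S ?h z + ?gain * indicator Z z \<le> ?S g z"
    using AE_space
  proof eventually_elim
    case (elim z)
    then have z: "z \<in> cube J" by simp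
    have upd: "z(j := t) \<in> cube I" if "t \<in> {0..1}" for t
      using cube_update[OF z that] J by simp
    obtain N where N: "{t \<in> space unit_interval. \<not> F (z(j := t)) = ereal (g (z(j := t)))} \<subseteq> N"
      "emeasure unit_interval N = 0" "N \<in> sets unit_interval"
      using AE_E[OF elim(1)] by blast
    have Nn: "N \<in> null_sets unit_interval" using N by auto
    \<comment> \<open>Deleting the null set \<open>N\<close> where \<open>F\<close> and
      \<open>g\<close> differ costs no measure; off \<open>Z\<close> the set is empty, so the same
      slice inequality applies there with zero gain.\<close>
    define A1 where "A1 = (if z \<in> Z then A - N else {})"
    have A1: "A1 \<in> sets unit_interval" "z \<in> Z \<Longrightarrow> measure unit_interval A1 = measure unit_interval A"
      "A1 \<subseteq> A" "A1 \<subseteq> {0..1}" "A1 \<inter> N = {}"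
      using sets(1) N Nn sets(1)[THEN sets.sets_into_space] by (auto simp: A1_def measure_Diff_null_set)
    define A1' where "A1' = (if z \<in> Z then A' - N else {})"
    have A1': "A1' \<in> sets unit_interval" "z \<in> Z \<Longrightarrow> measure unit_interval A1' = measure unit_interval A'"
      "A1' \<subseteq> A'" "A1' \<subseteq> {0..1}" "A1' \<inter> N = {}"
      using sets(2) N Nn sets(2)[THEN sets.sets_into_space] by (auto simp: A1'_def measure_Diff_null_set)
    have FN: "F (z(j := t)) = ereal (g (z(j := t)))" if "t \<in> {0..1}" "t \<notin> N" for t
      using N(1) that by auto
    have slice: "(\<lambda>t. g (z(j := t))) \<in> borel_measurable unit_interval"
      by (rule borel_slice_measurable[of g j J]) (use g(1) J cube_space_PiM[OF z] in auto)
    \<comment> \<open>Slices of \<open>f0\<close> are increasing at every point, hence measurable;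
      \<open>g0\<close> is replaced by \<open>f0\<close> on the slice for this reason.\<close>
    have slice0: "mono_on {0..1} (\<lambda>t. f0 (z(j := t)))"
      using upd by (intro mono_onI mono_onD[OF f0(1)]) (auto simp: le_fun_def)
    have rv: "?h (z(j := t)) = real_quantile m (\<lambda>t. g (z(j := t))) t" if "t \<in> {0..1}" for t
      using upd[OF that] by (simp add: rearr_version_def)
    have "(\<integral>\<^sup>+t. c (real_quantile m (\<lambda>t. g (z(j := t))) t - f0 (z(j := t))) \<partial>unit_interval) +
      ennreal (\<kappa> * min (measure unit_interval A1) (measure unit_interval A1'))
      \<le> (\<integral>\<^sup>+t. c (g (z(j := t)) - f0 (z(j := t))) \<partial>unit_interval)"
    proof (rule rearrangement_gain[where lo = "- B" and hi = B])
      have mq: "mono_on {0..1} (real_quantile m (\<lambda>t. g (z(j := t))))"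
        using slice C g(2) by (intro mono_on_real_quantile[of _ C]) auto
      then show "real_quantile m (\<lambda>t. g (z(j := t))) \<in> borel_measurable unit_interval"
        by (rule mono_on_unit_interval_measurable)
      show "mono_on {0..1} (real_quantile m (\<lambda>t. g (z(j := t))))" by fact
      show "(\<lambda>t. f0 (z(j := t))) \<in> borel_measurable unit_interval"
        using slice0 by (rule mono_on_unit_interval_measurable)
      show "distr unit_interval borel (real_quantile m (\<lambda>t. g (z(j := t)))) = distr unit_interval borel (\<lambda>t. g (z(j := t)))"
        using slice C g(2) by (intro distr_real_quantile[of _ C]) auto
      show "g (z(j := t)) \<in> {-B..B}" for t
      proof -
        have "g (z(j := t)) \<in> C" using g(2) by auto
        from B[OF this] show ?thesis by auto
      qed
      show "f0 (z(j := t)) \<in> {-B..B}" if "t \<in> {0..1}" for t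
      proof -
        have "f0 (z(j := t)) \<in> C" using f0(2) upd[OF that] by auto
        from B[OF this] show ?thesis by auto
      qed
      show "real_quantile m (\<lambda>t. g (z(j := t))) t \<in> {-B..B}" if "t \<in> {0..1}" for t
      proof -
        have "real_quantile m (\<lambda>t. g (z(j := t))) t \<in> C" using slice C g(2) that by (intro real_quantile_in) auto
        from B[OF this] show ?thesis by auto
      qed
      show "g (z(j := t)) \<le> g (z(j := s)) \<and> f0 (z(j := s)) \<le> f0 (z(j := t)) \<and>
        \<kappa> \<le> c (g (z(j := t)) - f0 (z(j := t))) + c (g (z(j := s)) - f0 (z(j := s)))
          - c (g (z(j := t)) - f0 (z(j := s))) - c (g (z(j := s)) - f0 (z(j := t)))"
        if st: "s \<in> A1" "t \<in> A1'" for s t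
      proof (rule gain)
        show "z \<in> Z" using st by (auto simp: A1_def split: if_splits)
        show "s \<in> A" "t \<in> A'" using st A1(3) A1'(3) by auto
        show "F (z(j := t)) = ereal (g (z(j := t)))" "F (z(j := s)) = ereal (g (z(j := s)))"
          using st A1(4,5) A1'(4,5) by (auto intro!: FN)
      qed (use g(2) in auto)
    qed (use slice slice0 A1(1) A1'(1) \<kappa> in auto)
    moreover have gain_le: "?gain * indicator Z z \<le> ennreal (\<kappa> * min (measure unit_interval A1) (measure unit_interval A1'))"
      using A1(2) A1'(2) by (auto simp: indicator_def)
    moreover have Sh: "?S ?h z = (\<integral>\<^sup>+t. c (real_quantile m (\<lambda>t. g (z(j := t))) t - f0 (z(j := t))) \<partial>unit_interval)"
    proof (rule nn_integral_cong_AE)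
      show "AE t in unit_interval. ennreal (c (?h (z(j := t)) - g0 (z(j := t)))) =
          ennreal (c (real_quantile m (\<lambda>t. g (z(j := t))) t - f0 (z(j := t))))"
        using elim(2) AE_space by eventually_elim (simp add: rv)
    qed
    moreover have Sg: "?S g z = (\<integral>\<^sup>+t. c (g (z(j := t)) - f0 (z(j := t))) \<partial>unit_interval)"
      using elim(2) by (intro nn_integral_cong_AE) (auto elim!: eventually_mono)
    ultimately show ?case
      unfolding Sh Sg by (elim order_trans[OF add_left_mono[OF gain_le]])
  qed
  have "(\<integral>\<^sup>+x. c (?h x - g0 x) \<partial>cube_measure I) + ?gain * emeasure (cube_measure J) Z =
    (\<integral>\<^sup>+z. ?S ?h z \<partial>cube_measure J) + (\<integral>\<^sup>+z. ?gain * indicator Z z \<partial>cube_measure J)"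
    using sets(3) by (simp add: S[OF h] nn_integral_cmult_indicator J_def)
  also have "\<dots> = (\<integral>\<^sup>+z. ?S ?h z + ?gain * indicator Z z \<partial>cube_measure J)"
    using sets(3) by (intro nn_integral_add[symmetric] S_meas borel_measurable_times borel_measurable_indicator) (auto simp: J_def)
  also have "\<dots> \<le> (\<integral>\<^sup>+z. ?S g z \<partial>cube_measure J)"
    using main by (rule nn_integral_mono_AE)
  also have "\<dots> = (\<integral>\<^sup>+x. c (g x - g0 x) \<partial>cube_measure I)"
    by (rule S[OF g(1), symmetric])
  finally show ?thesis by (simp add: J_def)
qed

lemma rearr_cost_le:
  assumes I: "finite I" "j \<in> I" and F: "borel_version I C F g" and F0: "borel_version I C (\<lambda>x. ereal (f0 x)) g0"
    and C: "closed C" "bounded C" "m \<in> C" "\<And>x. x \<in> C \<Longrightarrow> m \<le> x"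
    and f0: "mono_on (cube I) f0" "f0 \<in> cube I \<rightarrow> C"
  shows "(\<integral>\<^sup>+x. c (rearr_version I j m g x - g0 x) \<partial>cube_measure I) \<le> (\<integral>\<^sup>+x. c (g x - g0 x) \<partial>cube_measure I)"
  \<comment> \<open>Empty sets make the gain condition vacuous.\<close>
  using rearr_cost_gain[OF assms, of "{}" "{}" "{}" 0] by simp

end

section \<open>Power and excess costs\<close>

text \<open>Since \<open>0 powr a = 0\<close>, one formula serves all signs of \<open>u\<close>. At
  \<open>0\<close> the difference quotient is bounded by \<open>\<bar>h\<bar> powr (p - 1)\<close>,
  which tends to \<open>0\<close> because \<open>p > 1\<close>.\<close>

lemma has_real_derivative_abs_powr:
  fixes u p :: real
  assumes p: "p > 1"
  shows "((\<lambda>u. \<bar>u\<bar> powr p) has_real_derivative p * max 0 u powr (p - 1) - p * max 0 (- u) powr (p - 1)) (at u)"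
proof (cases u "0 :: real" rule: linorder_cases)
  case greater
  have "((\<lambda>u. \<bar>u\<bar> powr p) has_real_derivative p * u powr (p - 1)) (at u)"
  proof (rule has_field_derivative_transform_within_open)
    show "((\<lambda>u. u powr p) has_real_derivative p * u powr (p - 1)) (at u)"
      by (rule has_real_derivative_powr[OF greater])
    show "open {0 <..<u + 1}" by simp
  qed (use greater in auto)
  then show ?thesis using greater by (simp add: max_def)
next
  case less
  have "((\<lambda>u. \<bar>u\<bar> powr p) has_real_derivative - (p * (- u) powr (p - 1))) (at u)"
  proof (rule has_field_derivative_transform_within_open)
    show "((\<lambda>u. (- u) powr p) has_real_derivative - (p * (- u) powr (p - 1))) (at u)"
      using less by (auto intro!: derivative_eq_intros)
    show "open {u - 1<..<0}" by simp
  qed (use less in auto)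
  then show ?thesis using less by (simp add: max_def)
next
  case equal
  have "((\<lambda>h. \<bar>h\<bar>) \<longlongrightarrow> \<bar>0\<bar>) (at (0::real))"
    by (intro tendsto_intros)
  then have "((\<lambda>h. \<bar>h\<bar> powr (p - 1)) \<longlongrightarrow> \<bar>0\<bar> powr (p - 1)) (at (0::real))"
    using p by (intro tendsto_powr' tendsto_const) auto
  then have lim: "((\<lambda>h. \<bar>h\<bar> powr (p - 1)) \<longlongrightarrow> 0) (at (0::real))" using p by simp
  have "((\<lambda>h. \<bar>h\<bar> powr p / h) \<longlongrightarrow> 0) (at (0::real))"
  proof (rule Lim_null_comparison[OF _ lim])
    show "\<forall>\<^sub>F h in at (0::real). norm (\<bar>h\<bar> powr p / h) \<le> \<bar>h\<bar> powr (p - 1)"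
      by (auto simp: eventually_at_filter powr_diff)
  qed
  then show ?thesis using equal p by (simp add: has_field_derivative_iff)
qed

lemma continuous_on_abs_powr: "p > 0 \<Longrightarrow> continuous_on S (\<lambda>u :: real. \<bar>u\<bar> powr p)"
  by (intro continuous_on_powr') (auto intro!: continuous_intros)

lemma powr_cost:
  assumes p: "p > 1"
  shows "convex_cost (\<lambda>u. \<bar>u\<bar> powr p) (\<lambda>u. p * max 0 u powr (p - 1) - p * max 0 (- u) powr (p - 1))"
proof
  fix x y a b :: real
  show "0 \<le> \<bar>x\<bar> powr p" by simp
  show "continuous_on UNIV (\<lambda>u. \<bar>u\<bar> powr p)" using p by (intro continuous_on_abs_powr) simp
  show "p * max 0 x powr (p - 1) - p * max 0 (- x) powr (p - 1) \<le> p * max 0 y powr (p - 1) - p * max 0 (- y) powr (p - 1)"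
    if "x \<le> y"
    using p that by (intro diff_mono mult_left_mono powr_mono2) auto
  have "continuous_on UNIV (\<lambda>u :: real. p * max 0 u powr (p - 1) - p * max 0 (- u) powr (p - 1))"
    using p by (intro continuous_intros continuous_on_powr') auto
  then show "continuous (at_right x) (\<lambda>u. p * max 0 u powr (p - 1) - p * max 0 (- u) powr (p - 1))"
    by (rule continuous_at_imp_continuous_at_within[OF continuous_on_eq_continuous_at[OF open_UNIV, THEN iffD1, rule_format, OF _ UNIV_I]])
  show "((\<lambda>u. p * max 0 u powr (p - 1) - p * max 0 (- u) powr (p - 1)) has_integral \<bar>b\<bar> powr p - \<bar>a\<bar> powr p) {a..b}"
    if "a \<le> b"
    using that has_real_derivative_abs_powr[OF p]
    by (intro fundamental_theorem_of_calculus)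
      (auto simp: has_real_derivative_iff_has_vector_derivative[symmetric] intro: has_field_derivative_at_within)
qed

lemma continuous_at_right_step:
  fixes x M :: real
  shows "continuous (at_right x) (\<lambda>u. if u \<ge> M then a else b)"
proof -
  have "\<forall>\<^sub>F u in at_right x. (if u \<ge> M then a else b) = (if x \<ge> M then a else b)"
    unfolding eventually_at_right_field
  proof (cases "x \<ge> M")
    case True
    then show "\<exists>c>x. \<forall>u>x. u < c \<longrightarrow> (if u \<ge> M then a else b) = (if x \<ge> M then a else b)"
      by (intro exI[of _ "x + 1"]) auto
  next
    case False
    then show "\<exists>c>x. \<forall>u>x. u < c \<longrightarrow> (if u \<ge> M then a else b) = (if x \<ge> M then a else b)"
      by (intro exI[of _ M]) auto
  qed
  then show ?thesis
    unfolding continuous_within by (rule tendsto_eventually)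
qed

text \<open>This cost has integral zero exactly when the error is at most \<open>M\<close> almost
  everywhere, and at \<open>M = 0\<close> it is the absolute value. The slope is \<open>-1\<close>,
  \<open>0\<close>, \<open>1\<close> on the three pieces, with \<open>\<ge>\<close> at the kinks for
  right continuity.\<close>

lemma excess_cost:
  assumes M: "M \<ge> 0"
  shows "convex_cost (\<lambda>u. max 0 (\<bar>u\<bar> - M)) (\<lambda>u. (if u \<ge> M then 1 else 0) + (if u \<ge> - M then 0 else - 1))"
proof
  fix x y a b :: real
  show "0 \<le> max 0 (\<bar>x\<bar> - M)" by simp
  show "continuous_on UNIV (\<lambda>u. max 0 (\<bar>u\<bar> - M))" by (intro continuous_intros)
  show "(if M \<le> x then 1 else 0) + (if - M \<le> x then 0 else - 1) \<le> (if M \<le> y then 1 else 0) + (if - M \<le> y then 0 else (- 1 :: real))"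
    if "x \<le> y" using that by auto
  show "continuous (at_right x) (\<lambda>u. (if M \<le> u then 1 else 0) + (if - M \<le> u then 0 else (- 1 :: real)))"
    by (intro continuous_add continuous_at_right_step)
  show "((\<lambda>u. (if M \<le> u then 1 else 0) + (if - M \<le> u then 0 else - 1)) has_integral max 0 (\<bar>b\<bar> - M) - max 0 (\<bar>a\<bar> - M)) {a..b}"
    if "a \<le> b"
  proof (rule fundamental_theorem_of_calculus_interior_strong[where S = "{M, - M}"])
    fix u assume "u \<in> {a<..<b} - {M, - M}"
    then consider "u > M" | "u < - M" | "- M < u" "u < M" by fastforce
    then show "((\<lambda>u. max 0 (\<bar>u\<bar> - M)) has_vector_derivative (if M \<le> u then 1 else 0) + (if - M \<le> u then 0 else - 1)) (at u)"
      unfolding has_real_derivative_iff_has_vector_derivative[symmetric]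
    proof cases
      case 1
      have "((\<lambda>u. max 0 (\<bar>u\<bar> - M)) has_real_derivative 1) (at u)"
      proof (rule has_field_derivative_transform_within_open)
        show "((\<lambda>u. u - M) has_real_derivative 1) (at u)" by (auto intro!: derivative_eq_intros)
        show "open {M<..}" by simp
      qed (use 1 M in auto)
      then show "((\<lambda>u. max 0 (\<bar>u\<bar> - M)) has_real_derivative (if M \<le> u then 1 else 0) + (if - M \<le> u then 0 else - 1)) (at u)"
        using 1 M by simp
    next
      case 2
      have "((\<lambda>u. max 0 (\<bar>u\<bar> - M)) has_real_derivative - 1) (at u)"
      proof (rule has_field_derivative_transform_within_open)
        show "((\<lambda>u. - u - M) has_real_derivative - 1) (at u)" by (auto intro!: derivative_eq_intros)
        show "open {..< - M}" by simp
      qed (use 2 M in auto)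
      then show "((\<lambda>u. max 0 (\<bar>u\<bar> - M)) has_real_derivative (if M \<le> u then 1 else 0) + (if - M \<le> u then 0 else - 1)) (at u)"
        using 2 M by simp
    next
      case 3
      have "((\<lambda>u. max 0 (\<bar>u\<bar> - M)) has_real_derivative 0) (at u)"
      proof (rule has_field_derivative_transform_within_open)
        show "((\<lambda>u. 0) has_real_derivative 0) (at u)" by simp
        show "open {- M<..<M}" by simp
      qed (use 3 in auto)
      then show "((\<lambda>u. max 0 (\<bar>u\<bar> - M)) has_real_derivative (if M \<le> u then 1 else 0) + (if - M \<le> u then 0 else - 1)) (at u)"
        using 3 by simp
    qed
  qed (use that in \<open>auto intro!: continuous_intros\<close>)
qed

section \<open>The exchange constant and its positivity\<close>

definition exchange :: "real \<Rightarrow> real \<Rightarrow> real \<Rightarrow> real \<Rightarrow> real \<Rightarrow> real" where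
  "exchange p v v' t t' = \<bar>v - t'\<bar> powr p + \<bar>v' - t\<bar> powr p - \<bar>v - t\<bar> powr p - \<bar>v' - t'\<bar> powr p"

lemma eta_eq: "eta K \<epsilon> p = Inf {exchange p v v' t t' | v v' t t'.
    v \<in> K \<and> v' \<in> K \<and> t \<in> K \<and> t' \<in> K \<and> v' \<ge> v + \<epsilon> \<and> t' \<ge> t + \<epsilon>}"
  by (simp add: eta_def exchange_def)

text \<open>Strict convexity: \<open>u \<mapsto> \<bar>u + (t' - t)\<bar> powr p - \<bar>u\<bar> powr p\<close> is strictly increasing.\<close>

lemma exchange_pos:
  assumes p: "p > 1" and "v < v'" "t < t'"
  shows "exchange p v v' t t' > 0"
proof -
  define \<phi> where "\<phi> u = p * max 0 u powr (p - 1) - p * max 0 (- u) powr (p - 1)" for u :: real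
  have d: "((\<lambda>u. \<bar>u\<bar> powr p) has_real_derivative \<phi> u) (at u)" for u
    unfolding \<phi>_def by (rule has_real_derivative_abs_powr[OF p])
  \<comment> \<open>For \<open>b > 0\<close> the positive part grows strictly; otherwise
    \<open>a < b \<le> 0\<close> and the negative part shrinks strictly.\<close>
  have \<phi>: "\<phi> a < \<phi> b" if "a < b" for a b
  proof (cases "b > 0")
    case True
    have "max 0 a powr (p - 1) < max 0 b powr (p - 1)" using p that True by (intro powr_less_mono2) auto
    moreover have "max 0 (- b) powr (p - 1) \<le> max 0 (- a) powr (p - 1)" using p that by (intro powr_mono2) auto
    ultimately have "p * max 0 a powr (p - 1) < p * max 0 b powr (p - 1)"
      "p * max 0 (- b) powr (p - 1) \<le> p * max 0 (- a) powr (p - 1)"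
      using p by auto
    then show ?thesis unfolding \<phi>_def by linarith
  next
    case False
    have "max 0 (- b) powr (p - 1) < max 0 (- a) powr (p - 1)" using p that False by (intro powr_less_mono2) auto
    moreover have "max 0 a powr (p - 1) \<le> max 0 b powr (p - 1)" using p that by (intro powr_mono2) auto
    ultimately have "p * max 0 a powr (p - 1) \<le> p * max 0 b powr (p - 1)"
      "p * max 0 (- b) powr (p - 1) < p * max 0 (- a) powr (p - 1)"
      using p by auto
    then show ?thesis unfolding \<phi>_def by linarith
  qed
  let ?f = "\<lambda>u. \<bar>u + (t' - t)\<bar> powr p - \<bar>u\<bar> powr p"
  have "?f (v - t') < ?f (v' - t')"
  proof (rule DERIV_pos_imp_increasing[where f = ?f])
    show "v - t' < v' - t'" using assms by simp
    fix u
    have "((\<lambda>u. \<bar>u + (t' - t)\<bar> powr p) has_real_derivative \<phi> (u + (t' - t))) (at u)"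
      using DERIV_shift[of "\<lambda>u. \<bar>u\<bar> powr p" "\<phi> (u + (t' - t))" u "t' - t"] d by simp
    from DERIV_diff[OF this d[of u]]
    show "\<exists>y. ((\<lambda>u. \<bar>u + (t' - t)\<bar> powr p - \<bar>u\<bar> powr p) has_real_derivative y) (at u) \<and> 0 < y"
      using \<phi>[of u "u + (t' - t)"] assms(3) by auto
  qed
  then show ?thesis by (simp add: exchange_def)
qed

text \<open>Over \<open>closure K\<close> the constraints cut out a compact set, on which the
  continuous \<open>exchange\<close> attains a minimum; strict convexity makes it positive. The
  witnesses in \<open>K\<close> ensure that \<open>eta\<close> is not the \<open>Inf\<close> of the
  empty set.\<close>

lemma eta_pos:
  assumes p: "p > 1" and "\<epsilon> > 0" "bounded K"
    and ne: "v \<in> K" "v' \<in> K" "t \<in> K" "t' \<in> K" "v' \<ge> v + \<epsilon>" "t' \<ge> t + \<epsilon>"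
  shows "eta K \<epsilon> p > 0"
proof -
  define S where "S = ((closure K \<times> closure K) \<times> (closure K \<times> closure K)) \<inter>
     {x. fst (fst x) + \<epsilon> \<le> snd (fst x)} \<inter> {x. fst (snd x) + \<epsilon> \<le> snd (snd x)}"
  let ?D = "\<lambda>x. exchange p (fst (fst x)) (snd (fst x)) (fst (snd x)) (snd (snd x))"
  have cK: "compact (closure K)" using assms(3) by (simp add: compact_closure)
  have "compact S"
    unfolding S_def by (intro compact_Int_closed compact_Times cK closed_Collect_le continuous_intros)
  moreover have "((v, v'), (t, t')) \<in> S"
    using ne closure_subset[of K] by (auto simp: S_def)
  then have "S \<noteq> {}" by blast
  moreover have "continuous_on S ?D"
    unfolding exchange_def using p
    by (intro continuous_intros continuous_on_powr') auto
  ultimately obtain x0 where x0: "x0 \<in> S" "\<And>x. x \<in> S \<Longrightarrow> ?D x0 \<le> ?D x"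
    using continuous_attains_inf[of S ?D] by blast
  have "0 < ?D x0" using x0(1) assms(2) by (intro exchange_pos p) (auto simp: S_def)
  also have "?D x0 \<le> eta K \<epsilon> p"
    unfolding eta_eq
  proof (rule cInf_greatest)
    show "{exchange p v v' t t' | v v' t t'. v \<in> K \<and> v' \<in> K \<and> t \<in> K \<and> t' \<in> K \<and> v + \<epsilon> \<le> v' \<and> t + \<epsilon> \<le> t'} \<noteq> {}"
      using ne by blast
    fix y assume "y \<in> {exchange p v v' t t' | v v' t t'. v \<in> K \<and> v' \<in> K \<and> t \<in> K \<and> t' \<in> K \<and> v + \<epsilon> \<le> v' \<and> t + \<epsilon> \<le> t'}"
    then obtain a a' b b' where y: "y = exchange p a a' b b'" "a \<in> K" "a' \<in> K" "b \<in> K" "b' \<in> K" "a + \<epsilon> \<le> a'" "b + \<epsilon> \<le> b'"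
      by blast
    then have "((a, a'), (b, b')) \<in> S" using closure_subset[of K] by (auto simp: S_def)
    from x0(2)[OF this] show "?D x0 \<le> y" using y by simp
  qed
  finally show ?thesis .
qed

text \<open>
  Rearranged functions take values in \<open>closure K\<close> only; the strict inequality in \<open>v\<close> makes
  up for this.
\<close>

lemma eta_le_exchange:
  assumes p: "p > 1" and "\<epsilon> > 0" and v: "v \<in> closure K" "v' \<in> closure K" "v + \<epsilon> < v'"
    and t: "t \<in> K" "t' \<in> K" "t + \<epsilon> \<le> t'"
  shows "eta K \<epsilon> p \<le> exchange p v v' t t'"
    and "\<exists>w w'. w \<in> K \<and> w' \<in> K \<and> w + \<epsilon> \<le> w'"
proof -
  obtain x x' where x: "\<And>n. x n \<in> K" "x \<longlonglongrightarrow> v" and x': "\<And>n. x' n \<in> K" "x' \<longlonglongrightarrow> v'"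
    using v(1,2) unfolding closure_sequential by blast
  have "(\<lambda>n. x' n - x n) \<longlonglongrightarrow> v' - v" by (intro tendsto_diff x x')
  then have ev: "\<forall>\<^sub>F n in sequentially. \<epsilon> < x' n - x n"
    using v(3) by (intro order_tendstoD(1)[of _ "v' - v"]) auto
  then obtain n where "\<epsilon> < x' n - x n" by (auto dest: eventually_happens)
  then show "\<exists>w w'. w \<in> K \<and> w' \<in> K \<and> w + \<epsilon> \<le> w'"
    using x x' by (intro exI[of _ "x n"] exI[of _ "x' n"]) auto
  have "(\<lambda>n. exchange p (x n) (x' n) t t') \<longlonglongrightarrow> exchange p v v' t t'"
    unfolding exchange_def using p
    by (intro tendsto_intros x x') auto
  moreover have "\<forall>\<^sub>F n in sequentially. eta K \<epsilon> p \<le> exchange p (x n) (x' n) t t'"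
    using ev
  proof eventually_elim
    case (elim n)
    show ?case
      unfolding eta_eq
    proof (rule cInf_lower)
      show "exchange p (x n) (x' n) t t' \<in> {exchange p v v' t t' | v v' t t'.
          v \<in> K \<and> v' \<in> K \<and> t \<in> K \<and> t' \<in> K \<and> v' \<ge> v + \<epsilon> \<and> t' \<ge> t + \<epsilon>}"
        using x(1)[of n] x'(1)[of n] t elim
        by (intro CollectI exI[of _ "x n"] exI[of _ "x' n"] exI[of _ t] exI[of _ t']) auto
      show "bdd_below {exchange p v v' t t' | v v' t t'.
          v \<in> K \<and> v' \<in> K \<and> t \<in> K \<and> t' \<in> K \<and> v' \<ge> v + \<epsilon> \<and> t' \<ge> t + \<epsilon>}"
      proof (rule bdd_belowI[of _ 0])
        fix y assume "y \<in> {exchange p v v' t t' | v v' t t'.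
          v \<in> K \<and> v' \<in> K \<and> t \<in> K \<and> t' \<in> K \<and> v' \<ge> v + \<epsilon> \<and> t' \<ge> t + \<epsilon>}"
        then obtain a a' b b' where y: "y = exchange p a a' b b'" "a + \<epsilon> \<le> a'" "b + \<epsilon> \<le> b'"
          by blast
        then have "0 < exchange p a a' b b'" using assms(2) by (intro exchange_pos p) auto
        then show "0 \<le> y" using y by simp
      qed
    qed
  qed
  ultimately show "eta K \<epsilon> p \<le> exchange p v v' t t'"
    by (rule tendsto_lowerbound) simp
qed

section \<open>Minkowski's inequality for means\<close>

text \<open>For two positive points this is \<open>powr_convex\<close>; if one of them is
  \<open>0\<close>, it comes down to \<open>s powr p \<le> s\<close> for
  \<open>0 < s < 1\<close>.\<close>

lemma convex_on_powr_nonneg: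
  assumes "p \<ge> 1"
  shows "convex_on {0..} (\<lambda>x :: real. x powr p)"
proof (rule convex_onI)
  fix t x y :: real
  assume t: "0 < t" "t < 1" and xy: "x \<in> {0..}" "y \<in> {0..}"
  have small: "s powr p \<le> s" if "0 < s" "s < 1" for s :: real
    using powr_mono'[of 1 p s] assms that by simp
  consider "x = 0" | "y = 0" | "x > 0" "y > 0" using xy by force
  then show "((1 - t) *\<^sub>R x + t *\<^sub>R y) powr p \<le> (1 - t) * x powr p + t * y powr p"
  proof cases
    case 1
    then show ?thesis
      using mult_right_mono[OF small[OF t], of "y powr p"] t xy assms by (simp add: powr_mult)
  next
    case 2
    then show ?thesis
      using mult_right_mono[OF small[of "1 - t"], of "x powr p"] t xy assms by (simp add: powr_mult)
  next
    case 3
    then show ?thesis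
      using convex_onD[OF powr_convex[OF assms], of t x y] t by simp
  qed
qed simp

text \<open>
  Minkowski's inequality by Jensen: \<open>\<Sum>i\<in>P. u i x\<close> is \<open>S\<close> times a convex combination of the normalised
  \<open>\<bar>u i x\<bar> / b i\<close> with weights \<open>b i / S\<close>.
\<close>

lemma nn_integral_mean_powr_le:
  fixes u :: "'i \<Rightarrow> 'a \<Rightarrow> real" and N :: "'i \<Rightarrow> real"
  assumes P: "finite P" "P \<noteq> {}" and p: "p \<ge> 1"
    and [measurable]: "\<And>i. i \<in> P \<Longrightarrow> u i \<in> borel_measurable M"
    and N: "\<And>i. i \<in> P \<Longrightarrow> N i \<ge> 0" "\<And>i. i \<in> P \<Longrightarrow> (\<integral>\<^sup>+x. \<bar>u i x\<bar> powr p \<partial>M) \<le> ennreal (N i powr p)"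
  shows "(\<integral>\<^sup>+x. \<bar>(\<Sum>i\<in>P. u i x) / card P\<bar> powr p \<partial>M) \<le> ennreal (((\<Sum>i\<in>P. N i) / card P) powr p)"
proof -
  let ?n = "real (card P)"
  have n: "?n > 0" using P by (simp add: card_gt_0_iff)
  have eps: "(\<integral>\<^sup>+x. \<bar>(\<Sum>i\<in>P. u i x) / ?n\<bar> powr p \<partial>M) \<le> ennreal (((\<Sum>i\<in>P. N i) / ?n + e) powr p)" if e: "e > 0" for e :: real
  proof -
    \<comment> \<open>The surplus \<open>e\<close> keeps the normalisers positive even when some
      \<open>N i\<close> is \<open>0\<close>; it tends to \<open>0\<close> at the end of the
      proof.\<close>
    define b where "b i = N i + e" for i
    define S where "S = (\<Sum>i\<in>P. b i)"
    have b: "b i > 0" if "i \<in> P" for i using N(1)[OF that] e by (simp add: b_def)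
    have S: "S > 0" unfolding S_def using b P by (intro sum_pos) auto
    have pt: "\<bar>(\<Sum>i\<in>P. u i x) / ?n\<bar> powr p \<le> (\<Sum>i\<in>P. ((S / ?n) powr p * (b i / S) * (1 / b i) powr p) * \<bar>u i x\<bar> powr p)" for x
    proof -
      have "\<bar>(\<Sum>i\<in>P. u i x) / ?n\<bar> \<le> (\<Sum>i\<in>P. \<bar>u i x\<bar>) / ?n"
        using n by (simp add: abs_divide divide_right_mono sum_abs)
      also have "\<dots> = (S / ?n) * (\<Sum>i\<in>P. (b i / S) *\<^sub>R (\<bar>u i x\<bar> / b i))"
      proof -
        have "(\<Sum>i\<in>P. (b i / S) *\<^sub>R (\<bar>u i x\<bar> / b i)) = (\<Sum>i\<in>P. \<bar>u i x\<bar>) / S"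
          unfolding sum_divide_distrib by (intro sum.cong refl) (use b S in \<open>force simp: field_simps\<close>)
        then show ?thesis using S by simp
      qed
      finally have "\<bar>(\<Sum>i\<in>P. u i x) / ?n\<bar> powr p \<le> ((S / ?n) * (\<Sum>i\<in>P. (b i / S) *\<^sub>R (\<bar>u i x\<bar> / b i))) powr p"
        using p by (intro powr_mono2) auto
      also have "\<dots> = (S / ?n) powr p * (\<Sum>i\<in>P. (b i / S) *\<^sub>R (\<bar>u i x\<bar> / b i)) powr p"
        by (rule powr_mult)
      also have "\<dots> \<le> (S / ?n) powr p * (\<Sum>i\<in>P. (b i / S) * (\<bar>u i x\<bar> / b i) powr p)"
      proof (intro mult_left_mono convex_on_sum[OF P convex_on_powr_nonneg[OF p]])
        show "(\<Sum>i\<in>P. b i / S) = 1" using S by (simp add: sum_divide_distrib[symmetric] S_def)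
      qed (use b S in \<open>auto simp: less_imp_le\<close>)
      also have "\<dots> = (\<Sum>i\<in>P. ((S / ?n) powr p * (b i / S) * (1 / b i) powr p) * \<bar>u i x\<bar> powr p)"
        unfolding sum_distrib_left
      proof (intro sum.cong refl)
        fix i assume "i \<in> P"
        then have "(\<bar>u i x\<bar> / b i) powr p = \<bar>u i x\<bar> powr p * (1 / b i) powr p"
          using b[of i] powr_mult[of "\<bar>u i x\<bar>" "1 / b i" p] by simp
        then show "(S / ?n) powr p * (b i / S * (\<bar>u i x\<bar> / b i) powr p) =
          ((S / ?n) powr p * (b i / S) * (1 / b i) powr p) * \<bar>u i x\<bar> powr p" by simp
      qed
      finally show ?thesis .
    qed
    \<comment> \<open>The factor \<open>(1 / b i) powr p\<close> cancels against the integral bound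
      \<open>N i powr p \<le> b i powr p\<close>, leaving weights \<open>b i / S\<close> that sum to
      \<open>1\<close>.\<close>
    let ?w = "\<lambda>i. (S / ?n) powr p * (b i / S) * (1 / b i) powr p"
    have w: "0 \<le> ?w i" if "i \<in> P" for i using b[OF that] S by simp
    have "(\<integral>\<^sup>+x. \<bar>(\<Sum>i\<in>P. u i x) / ?n\<bar> powr p \<partial>M) \<le> (\<integral>\<^sup>+x. ennreal (\<Sum>i\<in>P. ?w i * \<bar>u i x\<bar> powr p) \<partial>M)"
      by (intro nn_integral_mono ennreal_leI pt)
    also have "\<dots> = (\<integral>\<^sup>+x. (\<Sum>i\<in>P. ennreal (?w i) * ennreal (\<bar>u i x\<bar> powr p)) \<partial>M)"
    proof (rule nn_integral_cong)
      fix x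
      have "ennreal (\<Sum>i\<in>P. ?w i * \<bar>u i x\<bar> powr p) = (\<Sum>i\<in>P. ennreal (?w i * \<bar>u i x\<bar> powr p))"
        by (intro sum_ennreal[symmetric] mult_nonneg_nonneg[OF w]) auto
      also have "\<dots> = (\<Sum>i\<in>P. ennreal (?w i) * ennreal (\<bar>u i x\<bar> powr p))"
        by (intro sum.cong refl ennreal_mult w) auto
      finally show "ennreal (\<Sum>i\<in>P. ?w i * \<bar>u i x\<bar> powr p) = (\<Sum>i\<in>P. ennreal (?w i) * ennreal (\<bar>u i x\<bar> powr p))" .
    qed
    also have "\<dots> = (\<Sum>i\<in>P. ennreal (?w i) * (\<integral>\<^sup>+x. \<bar>u i x\<bar> powr p \<partial>M))"
      by (subst nn_integral_sum) (auto intro!: sum.cong nn_integral_cmult)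
    also have "\<dots> \<le> (\<Sum>i\<in>P. ennreal ((S / ?n) powr p * (b i / S)))"
    proof (rule sum_mono)
      fix i assume i: "i \<in> P"
      have "ennreal (?w i) * (\<integral>\<^sup>+x. \<bar>u i x\<bar> powr p \<partial>M) \<le> ennreal (?w i) * ennreal (N i powr p)"
        by (intro mult_left_mono N(2)[OF i]) simp
      also have "\<dots> = ennreal (?w i * N i powr p)"
        using w[OF i] by (intro ennreal_mult[symmetric]) auto
      also have "\<dots> \<le> ennreal ((S / ?n) powr p * (b i / S))"
      proof (rule ennreal_leI)
        have "(1 / b i) powr p * N i powr p \<le> (1 / b i) powr p * b i powr p"
          using N(1)[OF i] e p by (intro mult_left_mono powr_mono2) (auto simp: b_def)
        also have "\<dots> = 1" using b[OF i] powr_mult[of "1 / b i" "b i" p] by simp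
        finally have "(S / ?n) powr p * (b i / S) * ((1 / b i) powr p * N i powr p) \<le> (S / ?n) powr p * (b i / S) * 1"
          using b[OF i] S by (intro mult_left_mono) auto
        then show "?w i * N i powr p \<le> (S / ?n) powr p * (b i / S)" by (simp add: mult.assoc)
      qed
      finally show "ennreal (?w i) * (\<integral>\<^sup>+x. \<bar>u i x\<bar> powr p \<partial>M) \<le> ennreal ((S / ?n) powr p * (b i / S))" .
    qed
    also have "\<dots> = ennreal (\<Sum>i\<in>P. (S / ?n) powr p * (b i / S))"
      using b S by (intro sum_ennreal mult_nonneg_nonneg) (auto simp: less_imp_le)
    also have "(\<Sum>i\<in>P. (S / ?n) powr p * (b i / S)) = (S / ?n) powr p"
      using S by (simp add: sum_distrib_left[symmetric] sum_divide_distrib[symmetric] S_def[symmetric])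
    also have "S / ?n = (\<Sum>i\<in>P. N i) / ?n + e"
      using n by (simp add: S_def b_def sum.distrib field_simps)
    finally show ?thesis .
  qed
  have "(\<lambda>k. ennreal (((\<Sum>i\<in>P. N i) / ?n + 1 / real (Suc k)) powr p)) \<longlonglongrightarrow> ennreal (((\<Sum>i\<in>P. N i) / ?n + 0) powr p)"
    using p n LIMSEQ_inverse_real_of_nat N(1)
    by (intro tendsto_ennrealI tendsto_powr' tendsto_add tendsto_const)
      (auto simp: inverse_eq_divide intro!: always_eventually sum_nonneg add_nonneg_nonneg)
  then have "(\<integral>\<^sup>+x. \<bar>(\<Sum>i\<in>P. u i x) / ?n\<bar> powr p \<partial>M) \<le> ennreal (((\<Sum>i\<in>P. N i) / ?n + 0) powr p)"
    by (rule LIMSEQ_le_const) (intro exI allI impI eps, simp)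
  then show ?thesis by simp
qed

section \<open>Errors of rearranged estimates\<close>

declare One_nat_def [simp del]

lemma epowr_ennreal: "0 \<le> r \<Longrightarrow> epowr (ennreal r) a = ennreal (r powr a)"
  by (simp add: epowr_def)

lemma epowr_mono: "0 \<le> a \<Longrightarrow> u \<le> v \<Longrightarrow> epowr u a \<le> epowr v a"
  by (auto simp: epowr_def top_unique less_top[symmetric] intro!: ennreal_leI powr_mono2 enn2real_mono)

lemma AE_ex_mem:
  assumes "AE x in M. P x" "S \<in> sets M" "measure M S > 0"
  shows "\<exists>x\<in>S. P x"
proof (rule ccontr)
  assume "\<not> (\<exists>x\<in>S. P x)"
  with assms(1) have "AE x in M. x \<notin> S" by (auto elim!: eventually_mono)
  then have "emeasure M S = 0"
    using assms(2) AE_iff_measurable[of S M "\<lambda>x. x \<notin> S"] sets.sets_into_space[OF assms(2)] by auto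
  then show False using assms(3) by (simp add: measure_def)
qed

text \<open>\<open>C\<close> will be \<open>closure K\<close> and \<open>m\<close> its least
  element. Both \<open>f0\<close> and a version \<open>g0\<close> are kept: the first is increasing
  everywhere, the second is Borel.\<close>

locale monotone_target =
  fixes d :: nat and C :: "real set" and m :: real and f0 g0 :: "(nat \<Rightarrow> real) \<Rightarrow> real"
  assumes C: "closed C" "bounded C" "m \<in> C" "\<And>x. x \<in> C \<Longrightarrow> m \<le> x"
    and f0: "mono_on (cube {1..d}) f0" "f0 \<in> cube {1..d} \<rightarrow> C"
    and F0: "borel_version {1..d} C (\<lambda>x. ereal (f0 x)) g0"
begin

abbreviation "Q \<equiv> cube_measure {1..d}"

abbreviation "version F g \<equiv> borel_version {1..d} C F g"

lemma version_rearr: "j \<in> {1..d} \<Longrightarrow> version F g \<Longrightarrow> version (rearr j F) (rearr_version {1..d} j m g)"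
  using C by (intro borel_version_rearr) auto

lemma version_AE: "version F g \<Longrightarrow> AE x in Q. F x - ereal (f0 x) = ereal (g x) - ereal (g0 x)"
  using F0 unfolding borel_version_def by (auto elim!: eventually_elim2)

lemma version_measurable:
  assumes "version F g"
  shows "g \<in> borel_measurable Q" "g0 \<in> borel_measurable Q"
  using assms F0 unfolding borel_version_def by (auto intro: borel_measurable_cube)

lemma lp_int_version:
  assumes "version F g"
  shows "lp_int d p (\<lambda>x. F x - ereal (f0 x)) = (\<integral>\<^sup>+x. \<bar>g x - g0 x\<bar> powr p \<partial>Q)"
  unfolding lp_int_def using version_AE[OF assms]
  by (intro nn_integral_cong_AE) (auto elim!: eventually_mono simp: epowr_ennreal)

lemma measurable_error:
  assumes "version F g"
  shows "(\<lambda>x. e2ennreal \<bar>F x - ereal (f0 x)\<bar>) \<in> borel_measurable Q"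
proof (rule measurable_cube_AE_cong)
  note [measurable] = version_measurable[OF assms]
  show "(\<lambda>x. ennreal \<bar>g x - g0 x\<bar>) \<in> borel_measurable Q" by measurable
  show "AE x in Q. e2ennreal \<bar>F x - ereal (f0 x)\<bar> = ennreal \<bar>g x - g0 x\<bar>"
    using version_AE[OF assms] by eventually_elim simp
qed auto

lemma emeasure_Q: "emeasure Q (space Q) = 1"
proof -
  have "emeasure Q (space Q) = (\<integral>\<^sup>+x. 1 \<partial>Q)" by simp
  also have "\<dots> = (\<integral>\<^sup>+x. indicator (cube {1..d}) x \<partial>(\<Pi>\<^sub>M i\<in>{1..d}. lborel))"
    by (subst nn_integral_cube) simp_all
  also have "\<dots> = emeasure (\<Pi>\<^sub>M i\<in>{1..d}. lborel) (cube {1..d})" by simp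
  also have "\<dots> = 1"
    unfolding cube_def by (subst lborel_product.emeasure_PiM) auto
  finally show ?thesis .
qed

text \<open>Finiteness lets the norms be handled as real numbers in Minkowski's inequality.\<close>

lemma lp_int_finite:
  assumes "version F g" "p \<ge> 0"
  shows "lp_int d p (\<lambda>x. F x - ereal (f0 x)) < \<top>"
proof -
  obtain B where B: "\<And>x. x \<in> C \<Longrightarrow> \<bar>x\<bar> \<le> B" using C(2) unfolding bounded_iff by auto
  have "\<bar>g x - g0 x\<bar> \<le> 2 * B" for x
  proof -
    have "g x \<in> C" "g0 x \<in> C" using assms F0 by (auto simp: borel_version_def)
    then have "\<bar>g x\<bar> \<le> B" "\<bar>g0 x\<bar> \<le> B" using B by auto
    then show ?thesis by linarith
  qed
  then have "lp_int d p (\<lambda>x. F x - ereal (f0 x)) \<le> (\<integral>\<^sup>+x. ennreal ((2 * B) powr p) \<partial>Q)"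
    unfolding lp_int_version[OF assms(1)] using assms(2)
    by (intro nn_integral_mono ennreal_leI powr_mono2) auto
  also have "\<dots> < \<top>" using emeasure_Q by (simp add: ennreal_mult_less_top)
  finally show ?thesis .
qed

lemma excess_integral_zero_iff:
  assumes "version F g"
  shows "(\<integral>\<^sup>+x. max 0 (\<bar>g x - g0 x\<bar> - M) \<partial>Q) = 0 \<longleftrightarrow> (AE x in Q. \<bar>g x - g0 x\<bar> \<le> M)"
proof -
  note [measurable] = version_measurable[OF assms]
  have "(\<integral>\<^sup>+x. max 0 (\<bar>g x - g0 x\<bar> - M) \<partial>Q) = 0 \<longleftrightarrow> (AE x in Q. ennreal (max 0 (\<bar>g x - g0 x\<bar> - M)) = 0)"
    by (rule nn_integral_0_iff_AE) measurable
  also have "\<dots> \<longleftrightarrow> (AE x in Q. \<bar>g x - g0 x\<bar> \<le> M)"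
    by (intro AE_cong) (auto simp: ennreal_eq_0_iff max_def)
  finally show ?thesis .
qed

lemma cost_rearr_le:
  assumes "convex_cost c \<phi>" "j \<in> {1..d}" "version F g"
  shows "(\<integral>\<^sup>+x. c (rearr_version {1..d} j m g x - g0 x) \<partial>Q) \<le> (\<integral>\<^sup>+x. c (g x - g0 x) \<partial>Q)"
  by (rule convex_cost.rearr_cost_le[OF assms(1) _ assms(2,3) F0 C f0]) simp

text \<open>At \<open>p = 1\<close> the slope formula of \<open>powr_cost\<close> fails to be
  right-continuous at \<open>0\<close>, because \<open>0 powr 0 = 0\<close>. The excess cost with
  threshold \<open>0\<close> takes over there.\<close>

lemma lp_int_rearr_le:
  assumes "p \<ge> 1" "j \<in> {1..d}" "version F g"
  shows "lp_int d p (\<lambda>x. rearr j F x - ereal (f0 x)) \<le> lp_int d p (\<lambda>x. F x - ereal (f0 x))"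
proof (cases "p = 1")
  case True
  then show ?thesis
    using cost_rearr_le[OF excess_cost[of 0] assms(2,3)]
    by (simp add: lp_int_version[OF version_rearr[OF assms(2,3)]] lp_int_version[OF assms(3)])
next
  case False
  then show ?thesis
    using cost_rearr_le[OF powr_cost assms(2,3), of p] assms(1)
    by (simp add: lp_int_version[OF version_rearr[OF assms(2,3)]] lp_int_version[OF assms(3)])
qed

text \<open>For \<open>p = \<top>\<close> the threshold \<open>M\<close> is the essential supremum
  of the original error: the integrated excess over \<open>M\<close> is zero before rearranging,
  hence also afterwards.\<close>

lemma lp_norm_rearr_le:
  assumes "p \<ge> 1" "j \<in> {1..d}" "version F g"
  shows "lp_norm d p (\<lambda>x. rearr j F x - ereal (f0 x)) \<le> lp_norm d p (\<lambda>x. F x - ereal (f0 x))"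
proof (cases "p = \<top>")
  case False
  then obtain r where r: "p = ennreal r" "r \<ge> 0" by (cases p) auto
  with assms(1) have "r \<ge> 1" by (metis ennreal_1 ennreal_le_iff)
  then show ?thesis
    using r by (auto simp: lp_norm_def intro!: epowr_mono lp_int_rearr_le assms)
next
  case True
  let ?e = "esssup Q (\<lambda>x. e2ennreal \<bar>F x - ereal (f0 x)\<bar>)"
  have v: "version (rearr j F) (rearr_version {1..d} j m g)"
    by (rule version_rearr[OF assms(2,3)])
  have "esssup Q (\<lambda>x. e2ennreal \<bar>rearr j F x - ereal (f0 x)\<bar>) \<le> ?e"
  proof (cases "?e = \<top>")
    case False
    then obtain M where M: "?e = ennreal M" "M \<ge> 0" by (cases ?e) auto
    have "AE x in Q. \<bar>g x - g0 x\<bar> \<le> M"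
      using esssup_AE[of "\<lambda>x. e2ennreal \<bar>F x - ereal (f0 x)\<bar>" Q] version_AE[OF assms(3)]
      by eventually_elim (use M in simp)
    then have "(\<integral>\<^sup>+x. max 0 (\<bar>g x - g0 x\<bar> - M) \<partial>Q) = 0"
      using excess_integral_zero_iff[OF assms(3)] by simp
    then have "(\<integral>\<^sup>+x. max 0 (\<bar>rearr_version {1..d} j m g x - g0 x\<bar> - M) \<partial>Q) = 0"
      using cost_rearr_le[OF excess_cost[OF M(2)] assms(2,3)] by simp
    then have "AE x in Q. \<bar>rearr_version {1..d} j m g x - g0 x\<bar> \<le> M"
      using excess_integral_zero_iff[OF v] by simp
    then have "AE x in Q. e2ennreal \<bar>rearr j F x - ereal (f0 x)\<bar> \<le> ?e"
      using version_AE[OF v] by eventually_elim (simp add: M ennreal_leI)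
    then show ?thesis by (intro esssup_I measurable_error[OF v])
  qed simp
  then show ?thesis using True by (simp add: lp_norm_def)
qed

text \<open>The existence of a version is carried along because each further rearrangement needs
  one. The bound on \<open>lp_int\<close> is kept beside that on \<open>lp_norm\<close> since a
  strict gain is subtracted under the root.\<close>

lemma foldr_rearr:
  assumes "set (map \<pi> ks) \<subseteq> {1..d}" "version F g"
  shows "(\<exists>g'. version (foldr (\<lambda>i. rearr (\<pi> i)) ks F) g') \<and>
    (\<forall>p\<ge>1. lp_int d p (\<lambda>x. foldr (\<lambda>i. rearr (\<pi> i)) ks F x - ereal (f0 x)) \<le> lp_int d p (\<lambda>x. F x - ereal (f0 x))) \<and>
    (\<forall>p\<ge>1. lp_norm d p (\<lambda>x. foldr (\<lambda>i. rearr (\<pi> i)) ks F x - ereal (f0 x)) \<le> lp_norm d p (\<lambda>x. F x - ereal (f0 x)))"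
  using assms(1)
proof (induction ks)
  case Nil
  then show ?case using assms(2) by auto
next
  case (Cons k ks)
  let ?F = "foldr (\<lambda>i. rearr (\<pi> i)) ks F"
  have k: "\<pi> k \<in> {1..d}" using Cons.prems by simp
  from Cons obtain g' where g': "version ?F g'" by auto
  have IH: "\<forall>p\<ge>1. lp_int d p (\<lambda>x. ?F x - ereal (f0 x)) \<le> lp_int d p (\<lambda>x. F x - ereal (f0 x))"
    "\<forall>p\<ge>1. lp_norm d p (\<lambda>x. ?F x - ereal (f0 x)) \<le> lp_norm d p (\<lambda>x. F x - ereal (f0 x))"
    using Cons by auto
  show ?case
    unfolding foldr.simps comp_apply
    by (intro conjI allI impI exI[where x = "rearr_version {1..d} (\<pi> k) m g'"] version_rearr[OF k g'])
      (blast intro: order_trans lp_int_rearr_le[OF _ k g'] lp_norm_rearr_le[OF _ k g'] IH[rule_format])+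
qed

text \<open>The slice gain is used with \<open>\<kappa> = eta K \<epsilon> p\<close>. Values of
  \<open>F\<close> are only known to lie in \<open>closure K\<close>, so
  \<open>eta_le_exchange\<close> supplies the bound.\<close>

lemma strict_gain:
  assumes p: "p > 1" and K: "C = closure K" "f0 \<in> cube {1..d} \<rightarrow> K" and j: "j \<in> {1..d}" and F: "version F g"
    and pos: "\<delta> > 0" "\<nu> > 0" "\<epsilon> > 0" and cond: "strict_gain_cond d j \<delta> \<nu> \<epsilon> F f0"
  shows "eta K \<epsilon> p > 0"
    and "lp_int d p (\<lambda>x. rearr j F x - ereal (f0 x)) + ennreal (eta K \<epsilon> p * \<delta> * \<nu>) \<le> lp_int d p (\<lambda>x. F x - ereal (f0 x))"
proof -
  let ?J = "{1..d} - {j}"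
  have J: "insert j ?J = {1..d}" "finite ?J" "j \<notin> ?J" using j by auto
  obtain A A' Z where sets: "A \<in> sets unit_interval" "A' \<in> sets unit_interval" "Z \<in> sets (cube_measure ?J)"
    and meas: "measure unit_interval A > \<delta>" "measure unit_interval A' > \<delta>" "measure (cube_measure ?J) Z = \<nu>"
    and gain: "\<And>s t z. s \<in> A \<Longrightarrow> t \<in> A' \<Longrightarrow> z \<in> Z \<Longrightarrow> F (z(j := s)) > F (z(j := t)) + ereal \<epsilon>"
      "\<And>s t z. s \<in> A \<Longrightarrow> t \<in> A' \<Longrightarrow> z \<in> Z \<Longrightarrow> f0 (z(j := t)) > f0 (z(j := s)) + \<epsilon>"
    using cond unfolding strict_gain_cond_def by blast
  have sub: "A \<subseteq> {0..1}" "A' \<subseteq> {0..1}" "Z \<subseteq> cube ?J"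
    using sets[THEN sets.sets_into_space] by auto
  have inK: "f0 (z(j := t)) \<in> K" if "z \<in> Z" "t \<in> {0..1}" for z t
  proof -
    have "z \<in> cube ?J" using that sub by auto
    from cube_update[OF this that(2), of j] show ?thesis using K(2) unfolding J(1) by auto
  qed
  have g: "g x \<in> C" for x using F by (auto simp: borel_version_def)
  have eta_le: "eta K \<epsilon> p \<le> exchange p v v' (f0 (z(j := s))) (f0 (z(j := t)))"
    and eta_ne: "\<exists>w w'. w \<in> K \<and> w' \<in> K \<and> w + \<epsilon> \<le> w'"
    and vv: "v \<le> v'"
    if "s \<in> A" "t \<in> A'" "z \<in> Z" "v \<in> C" "v' \<in> C" "F (z(j := t)) = ereal v" "F (z(j := s)) = ereal v'" for s t z v v'
  proof -
    have "v + \<epsilon> < v'" using gain(1)[OF that(1-3)] that(6,7) by simp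
    moreover have "f0 (z(j := s)) \<in> K" "f0 (z(j := t)) \<in> K" using that sub by (auto intro!: inK)
    ultimately show "eta K \<epsilon> p \<le> exchange p v v' (f0 (z(j := s))) (f0 (z(j := t)))"
      "\<exists>w w'. w \<in> K \<and> w' \<in> K \<and> w + \<epsilon> \<le> w'" "v \<le> v'"
      using eta_le_exchange[OF p pos(3), of v K v'] that gain(2)[OF that(1-3)] K(1) pos(3) by (simp_all add: less_imp_le)
  qed
  \<comment> \<open>The sets \<open>Z\<close>, \<open>A\<close> and \<open>A'\<close> have positive
    measure, so they contain points at which \<open>F\<close> has finite values in \<open>C\<close>;
    approximating these yields the two points \<open>w\<close>, \<open>w'\<close> of
    \<open>K\<close>, which serve as witnesses for both pairs in \<open>eta\<close>.\<close>
  show eta_pos: "eta K \<epsilon> p > 0"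
  proof -
    have "AE x in cube_measure (insert j ?J). F x = ereal (g x)"
      using F unfolding borel_version_def J(1) by auto
    from AE_cube_slice[OF J(2,3) this]
    obtain z where z: "z \<in> Z" "AE t in unit_interval. F (z(j := t)) = ereal (g (z(j := t)))"
      using AE_ex_mem[OF _ sets(3)] meas(3) pos by auto
    obtain s where s: "s \<in> A" "F (z(j := s)) = ereal (g (z(j := s)))"
      using AE_ex_mem[OF z(2) sets(1)] meas(1) pos by auto
    obtain t where t: "t \<in> A'" "F (z(j := t)) = ereal (g (z(j := t)))"
      using AE_ex_mem[OF z(2) sets(2)] meas(2) pos by auto
    obtain w w' where w: "w \<in> K" "w' \<in> K" "w + \<epsilon> \<le> w'"
      using eta_ne[OF s(1) t(1) z(1) g g t(2) s(2)] by blast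
    have "bounded K" using C(2) K(1) by (meson bounded_subset closure_subset)
    then show ?thesis by (rule eta_pos[OF p pos(3) _ w(1,2) w(1,2) w(3) w(3)])
  qed
  interpret convex_cost "\<lambda>u. \<bar>u\<bar> powr p" "\<lambda>u. p * max 0 u powr (p - 1) - p * max 0 (- u) powr (p - 1)"
    by (rule powr_cost[OF p])
  have "lp_int d p (\<lambda>x. rearr j F x - ereal (f0 x)) +
      ennreal (eta K \<epsilon> p * min (measure unit_interval A) (measure unit_interval A')) * emeasure (cube_measure ?J) Z
    \<le> lp_int d p (\<lambda>x. F x - ereal (f0 x))"
    unfolding lp_int_version[OF F] lp_int_version[OF version_rearr[OF j F]]
  proof (rule rearr_cost_gain[OF _ j F F0 C f0 sets])
    fix s t z v v'
    assume a: "s \<in> A" "t \<in> A'" "z \<in> Z" "v \<in> C" "v' \<in> C" "F (z(j := t)) = ereal v" "F (z(j := s)) = ereal v'"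
    show "v \<le> v' \<and> f0 (z(j := s)) \<le> f0 (z(j := t)) \<and>
       eta K \<epsilon> p \<le> \<bar>v - f0 (z(j := t))\<bar> powr p + \<bar>v' - f0 (z(j := s))\<bar> powr p
         - \<bar>v - f0 (z(j := s))\<bar> powr p - \<bar>v' - f0 (z(j := t))\<bar> powr p"
      using eta_le[OF a] vv[OF a] gain(2)[OF a(1-3)] pos(3) by (simp add: exchange_def)
  qed (use eta_pos in auto)
  moreover have "ennreal (eta K \<epsilon> p * \<delta> * \<nu>) \<le>
     ennreal (eta K \<epsilon> p * min (measure unit_interval A) (measure unit_interval A')) * emeasure (cube_measure ?J) Z"
  proof -
    \<comment> \<open>\<open>measure\<close> sends an infinite \<open>emeasure\<close> to
      \<open>0\<close>, so \<open>\<nu> > 0\<close> excludes that case.\<close>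
    have "emeasure (cube_measure ?J) Z = ennreal \<nu>"
      using meas(3) pos(2) emeasure_eq_ennreal_measure[of "cube_measure ?J" Z] by (auto simp: measure_def)
    moreover have "eta K \<epsilon> p * \<delta> \<le> eta K \<epsilon> p * min (measure unit_interval A) (measure unit_interval A')"
      using meas eta_pos by (intro mult_left_mono) auto
    ultimately show ?thesis
      using eta_pos pos
      by (subst ennreal_mult) (auto intro!: mult_right_mono ennreal_leI)
  qed
  ultimately show "lp_int d p (\<lambda>x. rearr j F x - ereal (f0 x)) + ennreal (eta K \<epsilon> p * \<delta> * \<nu>)
      \<le> lp_int d p (\<lambda>x. F x - ereal (f0 x))"
    using add_left_mono order_trans by blast
qed

text \<open>The error of a mean is the mean of the errors. Finite exponents then use Minkowski's
  inequality, the essential supremum the pointwise triangle inequality.\<close>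

lemma lp_norm_mean_le:
  fixes H :: "'i \<Rightarrow> (nat \<Rightarrow> real) \<Rightarrow> ereal"
  assumes P: "finite P" "P \<noteq> {}" and p: "p \<ge> 1" and H: "\<And>i. i \<in> P \<Longrightarrow> version (H i) (h i)"
  shows "lp_norm d p (\<lambda>x. (\<Sum>i\<in>P. H i x) / ereal (real (card P)) - ereal (f0 x))
    \<le> (\<Sum>i\<in>P. lp_norm d p (\<lambda>x. H i x - ereal (f0 x))) / of_nat (card P)"
proof -
  let ?n = "real (card P)" and ?A = "\<lambda>x. (\<Sum>i\<in>P. H i x) / ereal (real (card P)) - ereal (f0 x)"
  have n: "?n > 0" using P by (simp add: card_gt_0_iff)
  have [measurable]: "h i \<in> borel_measurable Q" if "i \<in> P" for i using version_measurable(1)[OF H[OF that]] .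
  have [measurable]: "g0 \<in> borel_measurable Q" by (rule version_measurable(2)[OF F0])
  have "AE x in Q. \<forall>i\<in>P. H i x = ereal (h i x)"
    using H P by (intro AE_finite_allI) (auto simp: borel_version_def)
  moreover have "AE x in Q. ereal (f0 x) = ereal (g0 x)" using F0 by (simp add: borel_version_def)
  ultimately have A: "AE x in Q. ?A x = ereal ((\<Sum>i\<in>P. h i x - g0 x) / ?n)"
  proof eventually_elim
    case (elim x)
    have "(\<Sum>i\<in>P. H i x) = ereal (\<Sum>i\<in>P. h i x)" using elim by (simp add: sum_ereal)
    then show ?case using elim n by (simp add: sum_subtractf diff_divide_distrib)
  qed
  show ?thesis
  proof (cases "p = \<top>")
    case False
    then obtain r where r: "p = ennreal r" "r \<ge> 0" by (cases p) auto
    with p have r1: "r \<ge> 1" by (metis ennreal_1 ennreal_le_iff)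
    define N where "N i = enn2real (lp_int d r (\<lambda>x. H i x - ereal (f0 x))) powr (1 / r)" for i
    have I: "lp_int d r (\<lambda>x. H i x - ereal (f0 x)) = ennreal (N i powr r)" if "i \<in> P" for i
      using lp_int_finite[OF H[OF that] r(2)] r1 by (simp add: N_def powr_powr)
    have "lp_int d r ?A = (\<integral>\<^sup>+x. \<bar>(\<Sum>i\<in>P. h i x - g0 x) / ?n\<bar> powr r \<partial>Q)"
      unfolding lp_int_def using A
      by (intro nn_integral_cong_AE) (auto elim!: eventually_mono simp: epowr_ennreal)
    also have "\<dots> \<le> ennreal (((\<Sum>i\<in>P. N i) / ?n) powr r)"
      using I lp_int_version[OF H] by (intro nn_integral_mean_powr_le P r1) (auto simp: N_def)
    finally have "epowr (lp_int d r ?A) (1 / r) \<le> epowr (ennreal (((\<Sum>i\<in>P. N i) / ?n) powr r)) (1 / r)"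
      using r by (intro epowr_mono) auto
    also have "\<dots> = ennreal ((\<Sum>i\<in>P. N i) / ?n)"
      using r1 n by (simp add: epowr_ennreal powr_powr N_def sum_nonneg)
    also have "\<dots> = (\<Sum>i\<in>P. ennreal (N i)) / of_nat (card P)"
      using n by (simp add: N_def sum_nonneg divide_ennreal[symmetric] ennreal_of_nat_eq_real_of_nat sum_ennreal)
    also have "(\<Sum>i\<in>P. ennreal (N i)) = (\<Sum>i\<in>P. lp_norm d p (\<lambda>x. H i x - ereal (f0 x)))"
    proof (intro sum.cong refl)
      fix i assume i: "i \<in> P"
      have "lp_norm d p (\<lambda>x. H i x - ereal (f0 x)) = epowr (lp_int d r (\<lambda>x. H i x - ereal (f0 x))) (1 / r)"
        using r by (simp add: lp_norm_def)
      also have "\<dots> = epowr (ennreal (N i powr r)) (1 / r)" by (simp only: I[OF i])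
      also have "\<dots> = ennreal (N i)" using r1 by (simp add: epowr_ennreal powr_powr N_def)
      finally show "ennreal (N i) = lp_norm d p (\<lambda>x. H i x - ereal (f0 x))" ..
    qed
    finally show ?thesis using r by (simp add: lp_norm_def)
  next
    case True
    have "esssup Q (\<lambda>x. e2ennreal \<bar>?A x\<bar>) \<le> (\<Sum>i\<in>P. esssup Q (\<lambda>x. e2ennreal \<bar>H i x - ereal (f0 x)\<bar>)) / of_nat (card P)"
    proof (rule esssup_I)
      show "(\<lambda>x. e2ennreal \<bar>?A x\<bar>) \<in> borel_measurable Q"
      proof (rule measurable_cube_AE_cong)
        show "(\<lambda>x. ennreal \<bar>(\<Sum>i\<in>P. h i x - g0 x) / ?n\<bar>) \<in> borel_measurable Q" by measurable
        show "AE x in Q. e2ennreal \<bar>?A x\<bar> = ennreal \<bar>(\<Sum>i\<in>P. h i x - g0 x) / ?n\<bar>"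
          using A by eventually_elim simp
      qed auto
      have "AE x in Q. \<forall>i\<in>P. ennreal \<bar>h i x - g0 x\<bar> \<le> esssup Q (\<lambda>x. e2ennreal \<bar>H i x - ereal (f0 x)\<bar>)"
      proof (intro AE_finite_allI P)
        fix i assume i: "i \<in> P"
        show "AE x in Q. ennreal \<bar>h i x - g0 x\<bar> \<le> esssup Q (\<lambda>x. e2ennreal \<bar>H i x - ereal (f0 x)\<bar>)"
          using esssup_AE[of "\<lambda>x. e2ennreal \<bar>H i x - ereal (f0 x)\<bar>" Q] version_AE[OF H[OF i]]
          by eventually_elim simp
      qed
      with A show "AE x in Q. e2ennreal \<bar>?A x\<bar> \<le>
        (\<Sum>i\<in>P. esssup Q (\<lambda>x. e2ennreal \<bar>H i x - ereal (f0 x)\<bar>)) / of_nat (card P)"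
      proof eventually_elim
        case (elim x)
        have "e2ennreal \<bar>?A x\<bar> = ennreal \<bar>(\<Sum>i\<in>P. h i x - g0 x) / ?n\<bar>"
          using elim(1) by simp
        also have "\<dots> \<le> ennreal ((\<Sum>i\<in>P. \<bar>h i x - g0 x\<bar>) / ?n)"
          using n by (intro ennreal_leI) (simp add: abs_divide divide_right_mono sum_abs)
        also have "\<dots> = (\<Sum>i\<in>P. ennreal \<bar>h i x - g0 x\<bar>) / of_nat (card P)"
          using n by (simp add: sum_nonneg divide_ennreal[symmetric] ennreal_of_nat_eq_real_of_nat sum_ennreal)
        also have "\<dots> \<le> (\<Sum>i\<in>P. esssup Q (\<lambda>x. e2ennreal \<bar>H i x - ereal (f0 x)\<bar>)) / of_nat (card P)"
          using elim(2) by (intro divide_right_mono_ennreal sum_mono) auto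
        finally show ?case .
      qed
    qed
    then show ?thesis using True by (simp add: lp_norm_def)
  qed
qed

end

section \<open>Monotonicity of rearranged functions\<close>

lemma rearr_mono:
  assumes f: "\<And>x x'. x \<in> cube I \<Longrightarrow> x' \<in> cube I \<Longrightarrow> x \<le> x' \<Longrightarrow> (\<And>i. i \<in> I - S \<Longrightarrow> x i = x' i) \<Longrightarrow> f x \<le> f x'"
    and j: "j \<in> I" and x: "x \<in> cube I" "x' \<in> cube I" "x \<le> x'" "\<And>i. i \<in> I - insert j S \<Longrightarrow> x i = x' i"
  shows "rearr j f x \<le> rearr j f x'"
  unfolding rearr_eq_quantile
proof (rule quantile_mono)
  show "x j \<le> x' j" using x(3) by (simp add: le_fun_def)
  fix t :: real assume t: "t \<in> {0..1}"
  show "f (x(j := t)) \<le> f (x'(j := t))"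
  proof (rule f)
    show "x(j := t) \<in> cube I" "x'(j := t) \<in> cube I"
      using cube_update[OF x(1) t, of j] cube_update[OF x(2) t, of j] j by (simp_all add: insert_absorb)
    show "x(j := t) \<le> x'(j := t)" using x(3) by (simp add: le_fun_def)
    \<comment> \<open>Coordinate \<open>j\<close> is overwritten by the same \<open>t\<close> in
      both points, so they can now differ only inside \<open>S\<close>.\<close>
    show "(x(j := t)) i = (x'(j := t)) i" if "i \<in> I - S" for i
      using x(4) that by (cases "i = j") auto
  qed
qed

text \<open>The invariant is monotonicity along pairs that differ only in coordinates already
  rearranged. Each rearrangement adds its coordinate to this set and preserves what was gained for
  the others.\<close>

lemma foldr_rearr_mono:
  assumes "set (map \<pi> ks) \<subseteq> I" "x \<in> cube I" "x' \<in> cube I" "x \<le> x'" "\<And>i. i \<in> I - set (map \<pi> ks) \<Longrightarrow> x i = x' i"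
  shows "foldr (\<lambda>i. rearr (\<pi> i)) ks f x \<le> foldr (\<lambda>i. rearr (\<pi> i)) ks f x'"
  using assms
proof (induction ks arbitrary: x x')
  case Nil
  \<comment> \<open>With no coordinate rearranged, comparable pairs coincide, which is why
    \<open>f\<close> may be arbitrary.\<close>
  then have "x = x'" by (intro PiE_ext[of x I "\<lambda>_. {0..1}" x']) (auto simp: cube_def)
  then show ?case by simp
next
  case (Cons k ks)
  have "rearr (\<pi> k) (foldr (\<lambda>i. rearr (\<pi> i)) ks f) x \<le> rearr (\<pi> k) (foldr (\<lambda>i. rearr (\<pi> i)) ks f) x'"
    by (rule rearr_mono[where I = I and S = "set (map \<pi> ks)"]) (use Cons in auto)
  then show ?case by simp
qed

lemma pi_rearr_mono:
  assumes "\<pi> \<in> orderings d"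
  shows "mono_on (cube {1..d}) (pi_rearr d \<pi> f)"
proof (rule mono_onI)
  fix x x' assume x: "x \<in> cube {1..d}" "x' \<in> cube {1..d}" "x \<le> x'"
  have "\<pi> ` {1..d} = {1..d}" using assms by (auto simp: orderings_def permutes_image)
  then have "set (map \<pi> [1..<Suc d]) = {1..d}" by (simp add: atLeastLessThanSuc_atLeastAtMost del: upt_Suc)
  then show "pi_rearr d \<pi> f x \<le> pi_rearr d \<pi> f x'"
    unfolding pi_rearr_def rearr_from_def using x by (intro foldr_rearr_mono[of _ _ "{1..d}"]) auto
qed

lemma avg_rearr_mono:
  assumes "P \<subseteq> orderings d" "finite P" "P \<noteq> {}"
  shows "mono_on (cube {1..d}) (avg_rearr d P f)"
proof (rule mono_onI)
  fix x x' assume x: "x \<in> cube {1..d}" "x' \<in> cube {1..d}" "x \<le> x'"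
  have "0 < card P" using assms by (simp add: card_gt_0_iff)
  then show "avg_rearr d P f x \<le> avg_rearr d P f x'"
    unfolding avg_rearr_def using assms x
    by (intro ereal_divide_right_mono sum_mono mono_onD[OF pi_rearr_mono]) auto
qed

section \<open>Isolating one stage of an ordering, and assembly of the four assertions\<close>

lemma rearr_from_split:
  assumes "k \<in> {1..d}"
  shows "pi_rearr d \<pi> f = foldr (\<lambda>i. rearr (\<pi> i)) [1..<k] (rearr (\<pi> k) (rearr_from (k + 1) d \<pi> f))"
proof -
  have "[1..<Suc d] = [1..<k] @ [k..<Suc d]"
    using upt_add_eq_append[of 1 k "Suc d - k"] assms by (simp del: upt_Suc)
  also have "[k..<Suc d] = k # [k + 1..<Suc d]" using assms by (simp only: upt_conv_Cons[of k "Suc d"] Suc_eq_plus1[symmetric] less_Suc_eq_le atLeastAtMost_iff)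
  finally show ?thesis by (simp add: pi_rearr_def rearr_from_def del: upt_Suc)
qed

theorem proposition2:
  fixes d :: nat and K :: "real set"
    and f0 fhat fbar :: "(nat \<Rightarrow> real) \<Rightarrow> real"
    and P :: "(nat \<Rightarrow> nat) set"
  assumes "d \<ge> 1" and "bounded K"
    and "f0 \<in> cube {1..d} \<rightarrow> K" and "f0 \<in> borel_measurable (cube_measure {1..d})"
    and "mono_on (cube {1..d}) f0"
    and "fhat \<in> cube {1..d} \<rightarrow> K" and "fhat \<in> borel_measurable (cube_measure {1..d})"
    and "fbar \<in> cube {1..d} \<rightarrow> K" and "fbar \<in> borel_measurable (cube_measure {1..d})"
    and "P \<subseteq> orderings d" and "finite P" and "P \<noteq> {}"
  shows
    "(\<forall>\<pi>\<in>orderings d. mono_on (cube {1..d}) (pi_rearr d \<pi> fhat)) \<and>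
     mono_on (cube {1..d}) (avg_rearr d P fhat) \<and>

     (\<forall>j\<in>{1..d}. \<forall>p\<ge>1.
        lp_norm d p (\<lambda>x. rearr j fbar x - ereal (f0 x))
        \<le> lp_norm d p (\<lambda>x. ereal (fbar x) - ereal (f0 x))) \<and>
     (\<forall>\<pi>\<in>orderings d. \<forall>p\<ge>1.
        lp_norm d p (\<lambda>x. pi_rearr d \<pi> fhat x - ereal (f0 x))
        \<le> lp_norm d p (\<lambda>x. ereal (fhat x) - ereal (f0 x))) \<and>

     (\<forall>j\<in>{1..d}. \<forall>\<delta>>0. \<forall>\<nu>>0. \<forall>\<epsilon>>0.
        strict_gain_cond d j \<delta> \<nu> \<epsilon> fbar f0 \<longrightarrow>
        (\<forall>p>1. eta K \<epsilon> p > 0 \<and>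
           ennreal (eta K \<epsilon> p * \<delta> * \<nu>) \<le> lp_int d p (\<lambda>x. ereal (fbar x) - ereal (f0 x)) \<and>
           epowr (lp_int d p (\<lambda>x. rearr j fbar x - ereal (f0 x))) (1 / p)
           \<le> epowr (lp_int d p (\<lambda>x. ereal (fbar x) - ereal (f0 x))
                     - ennreal (eta K \<epsilon> p * \<delta> * \<nu>)) (1 / p))) \<and>
     (\<forall>\<pi>\<in>orderings d. \<forall>k\<in>{1..d}. \<forall>\<delta>>0. \<forall>\<nu>>0. \<forall>\<epsilon>>0.
        strict_gain_cond d (\<pi> k) \<delta> \<nu> \<epsilon> (rearr_from (k + 1) d \<pi> fhat) f0 \<longrightarrow>
        (\<forall>p>1. eta K \<epsilon> p > 0 \<and>
           ennreal (eta K \<epsilon> p * \<delta> * \<nu>) \<le> lp_int d p (\<lambda>x. ereal (fhat x) - ereal (f0 x)) \<and>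
           epowr (lp_int d p (\<lambda>x. pi_rearr d \<pi> fhat x - ereal (f0 x))) (1 / p)
           \<le> epowr (lp_int d p (\<lambda>x. ereal (fhat x) - ereal (f0 x))
                     - ennreal (eta K \<epsilon> p * \<delta> * \<nu>)) (1 / p))) \<and>

     (\<forall>p\<ge>1.
        lp_norm d p (\<lambda>x. avg_rearr d P fhat x - ereal (f0 x))
        \<le> (\<Sum>\<pi>\<in>P. lp_norm d p (\<lambda>x. pi_rearr d \<pi> fhat x - ereal (f0 x))) / of_nat (card P))"
proof -
  define C where "C = closure K"
  \<comment> \<open>The value of \<open>f0\<close> at the origin shows that \<open>K\<close> is
    nonempty, so that \<open>Inf C\<close> is a least element of \<open>C\<close>.\<close>
  have "(\<lambda>i\<in>{1..d}. 0) \<in> cube {1..d}" by (auto simp: cube_def)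
  then have ne: "K \<noteq> {}" using assms(3) by auto
  have C: "closed C" "bounded C" "C \<noteq> {}" "K \<subseteq> C"
    using assms(2) ne closure_subset by (auto simp: C_def bounded_closure)
  have version: "\<exists>g. borel_version {1..d} C (\<lambda>x. ereal (f x)) g"
    if "f \<in> cube {1..d} \<rightarrow> K" "f \<in> borel_measurable (cube_measure {1..d})" for f
  proof -
    have "f \<in> cube {1..d} \<rightarrow> C" using that(1) C(4) by auto
    from cube_measure_borel_version[OF _ that(2) this C(1,3)] obtain g where
      "g \<in> borel_measurable (\<Pi>\<^sub>M i\<in>{1..d}. lborel)" "range g \<subseteq> C" "AE x in cube_measure {1..d}. f x = g x" by auto
    then show ?thesis by (auto simp: borel_version_def)
  qed
  obtain g0 where g0: "borel_version {1..d} C (\<lambda>x. ereal (f0 x)) g0" using version assms by blast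
  interpret monotone_target d C "Inf C" f0 g0
  proof
    show "Inf C \<in> C" using C by (intro closed_contains_Inf bounded_imp_bdd_below) auto
    show "\<And>x. x \<in> C \<Longrightarrow> Inf C \<le> x" using C by (intro cInf_lower bounded_imp_bdd_below)
    show "f0 \<in> cube {1..d} \<rightarrow> C" using assms(3) C(4) by auto
  qed (use C assms g0 in auto)
  obtain ghat where ghat: "version (\<lambda>x. ereal (fhat x)) ghat" using version assms by blast
  obtain gbar where gbar: "version (\<lambda>x. ereal (fbar x)) gbar" using version assms by blast
  have perm: "set (map \<pi> [a..<b]) \<subseteq> {1..d}" if "\<pi> \<in> orderings d" "1 \<le> a" "b \<le> Suc d" for \<pi> a b
    using that permutes_in_image[of \<pi> "{1..d}"] by (auto simp: orderings_def)
  \<comment> \<open>Subtraction in \<open>ennreal\<close> truncates at \<open>0\<close>; the first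
    conjunct certifies that no truncation takes place.\<close>
  have epowr_diff: "ennreal a \<le> v \<and> epowr w (1 / p) \<le> epowr (v - ennreal a) (1 / p)"
    if "w + ennreal a \<le> v" "p > 1" for a p :: real and v w
  proof
    show "ennreal a \<le> v" using that(1) by (rule order_trans[OF add_increasing, rotated 2]) simp_all
    have "w \<le> v - ennreal a" using that(1) by (simp add: ennreal_le_minus_iff)
    then show "epowr w (1 / p) \<le> epowr (v - ennreal a) (1 / p)" using that(2) by (intro epowr_mono) auto
  qed
  have part1: "\<forall>\<pi>\<in>orderings d. mono_on (cube {1..d}) (pi_rearr d \<pi> fhat)"
    by (auto intro: pi_rearr_mono)
  have part1': "mono_on (cube {1..d}) (avg_rearr d P fhat)"
    by (intro avg_rearr_mono assms)
  have part2a: "\<forall>j\<in>{1..d}. \<forall>p\<ge>1. lp_norm d p (\<lambda>x. rearr j fbar x - ereal (f0 x))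
        \<le> lp_norm d p (\<lambda>x. ereal (fbar x) - ereal (f0 x))"
    using lp_norm_rearr_le[OF _ _ gbar] by blast
  have part2b: "\<forall>\<pi>\<in>orderings d. \<forall>p\<ge>1. lp_norm d p (\<lambda>x. pi_rearr d \<pi> fhat x - ereal (f0 x))
        \<le> lp_norm d p (\<lambda>x. ereal (fhat x) - ereal (f0 x))"
    unfolding pi_rearr_def rearr_from_def using foldr_rearr[OF perm ghat, of _ 1 "Suc d"] by blast
  have part3a: "eta K \<epsilon> p > 0 \<and> ennreal (eta K \<epsilon> p * \<delta> * \<nu>) \<le> lp_int d p (\<lambda>x. ereal (fbar x) - ereal (f0 x)) \<and>
      epowr (lp_int d p (\<lambda>x. rearr j fbar x - ereal (f0 x))) (1 / p)
       \<le> epowr (lp_int d p (\<lambda>x. ereal (fbar x) - ereal (f0 x)) - ennreal (eta K \<epsilon> p * \<delta> * \<nu>)) (1 / p)"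
    if "j \<in> {1..d}" "\<delta> > 0" "\<nu> > 0" "\<epsilon> > 0" "strict_gain_cond d j \<delta> \<nu> \<epsilon> fbar f0" "p > 1" for j \<delta> \<nu> \<epsilon> p
    using strict_gain[OF that(6) C_def assms(3) that(1) gbar that(2-5)] epowr_diff[OF _ that(6)] by blast
  have part3b: "eta K \<epsilon> p > 0 \<and> ennreal (eta K \<epsilon> p * \<delta> * \<nu>) \<le> lp_int d p (\<lambda>x. ereal (fhat x) - ereal (f0 x)) \<and>
      epowr (lp_int d p (\<lambda>x. pi_rearr d \<pi> fhat x - ereal (f0 x))) (1 / p)
       \<le> epowr (lp_int d p (\<lambda>x. ereal (fhat x) - ereal (f0 x)) - ennreal (eta K \<epsilon> p * \<delta> * \<nu>)) (1 / p)"
    if \<pi>: "\<pi> \<in> orderings d" "k \<in> {1..d}" and pos: "\<delta> > 0" "\<nu> > 0" "\<epsilon> > 0"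
      and cond: "strict_gain_cond d (\<pi> k) \<delta> \<nu> \<epsilon> (rearr_from (k + 1) d \<pi> fhat) f0" and p: "p > 1" for \<pi> k \<delta> \<nu> \<epsilon> p
  proof -
    let ?F = "rearr_from (k + 1) d \<pi> fhat"
    have k: "\<pi> k \<in> {1..d}" using perm[OF \<pi>(1), of k "Suc k"] \<pi>(2) by auto
    obtain g where g: "version ?F g" and le: "lp_int d p (\<lambda>x. ?F x - ereal (f0 x)) \<le> lp_int d p (\<lambda>x. ereal (fhat x) - ereal (f0 x))"
      unfolding rearr_from_def using foldr_rearr[OF perm[OF \<pi>(1)] ghat, of "k + 1" "Suc d"] p by auto
    \<comment> \<open>The stages applied after stage \<open>k\<close> cannot raise the error again,
      and by \<open>le\<close> those applied before it have not raised it; the gain of stage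
      \<open>k\<close> survives.\<close>
    have "lp_int d p (\<lambda>x. pi_rearr d \<pi> fhat x - ereal (f0 x)) \<le> lp_int d p (\<lambda>x. rearr (\<pi> k) ?F x - ereal (f0 x))"
      unfolding rearr_from_split[OF \<pi>(2)]
      using foldr_rearr[OF perm[OF \<pi>(1)] version_rearr[OF k g], of 1 k] \<pi>(2) p by auto
    then have "lp_int d p (\<lambda>x. pi_rearr d \<pi> fhat x - ereal (f0 x)) + ennreal (eta K \<epsilon> p * \<delta> * \<nu>)
      \<le> lp_int d p (\<lambda>x. rearr (\<pi> k) ?F x - ereal (f0 x)) + ennreal (eta K \<epsilon> p * \<delta> * \<nu>)"
      by (rule add_right_mono)
    also have "\<dots> \<le> lp_int d p (\<lambda>x. ?F x - ereal (f0 x))"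
      by (rule strict_gain(2)[OF p C_def assms(3) k g pos cond])
    also note le
    finally show ?thesis
      using strict_gain(1)[OF p C_def assms(3) k g pos cond] epowr_diff[OF _ p] by blast
  qed
  have part4: "lp_norm d p (\<lambda>x. avg_rearr d P fhat x - ereal (f0 x))
        \<le> (\<Sum>\<pi>\<in>P. lp_norm d p (\<lambda>x. pi_rearr d \<pi> fhat x - ereal (f0 x))) / of_nat (card P)" if "p \<ge> 1" for p
  proof -
    have "\<forall>\<pi>\<in>P. \<exists>g. version (pi_rearr d \<pi> fhat) g"
      unfolding pi_rearr_def rearr_from_def
      using foldr_rearr[OF perm ghat, of _ 1 "Suc d"] assms(10) by auto
    then obtain h where "\<And>\<pi>. \<pi> \<in> P \<Longrightarrow> version (pi_rearr d \<pi> fhat) (h \<pi>)" by metis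
    from lp_norm_mean_le[OF assms(11,12) that this] show ?thesis by (simp add: avg_rearr_def)
  qed
  show ?thesis
    using part1 part1' part2a part2b part3a part3b part4 by (intro conjI ballI allI impI) simp_all
qed

end
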